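(* Checking satisfiability of $\mathcal{L}^{\mathit{dyn}}$-formulas relative to the class $\mathbf{MCM}$ is decidable.
   Context: Let $\mathit{Atm}_0$ be a countable set of atomic propositions and $\mathit{Val}$ a finite set of output values; decision atoms $\mathsf{t}(x)$ for $x\in\mathit{Val}$. Language $\mathcal{L}^{\mathit{dyn}}$: $\varphi ::= p \mid \mathsf{t}(x)\mid \neg\varphi\mid \varphi\wedge\varphi\mid \Box_{\mathtt{I}}\varphi\mid \Box_{\mathtt{F}}\varphi\mid[\varphi]\psi$ ($p\in\mathit{Atm}_0$, $x\in\mathit{Val}$). A multi-classifier model (MCM) is a pair $\Gamma=(S,\Phi)$ with $S\subseteq 2^{\mathit{Atm}_0}$ and $\Phi$ a set of functions from $S$ to $\mathit{Val}$. For $s\in S$, $f\in\Phi$: $(\Gamma,s,f)\models p$ iff $p\in s$; $(\Gamma,s,f)\models\mathsf{t}(x)$ iff $f(s)=x$; Boolean connectives as usual; $(\Gamma,s,f)\models\Box_{\mathtt{I}}\varphi$ iff $(\Gamma,s',f)\models\varphi$ for all $s'\in S$; $(\Gamma,s,f)\models\Box_{\mathtt{F}}\varphi$ iff $(\Gamma,s,f')\models\varphi$ for all $f'\in\Phi$; $(\Gamma,s,f)\models[\varphi]\psi$ iff, if $(\Gamma,s,f)\models\Box_{\mathtt{I}}\varphi$ then $(\Gamma^\varphi,s,f)\models\psi$, where $\Gamma^\varphi=(S,\Phi^\varphi)$ with $\Phi^\varphi=\{f'\in\Phi:\forall s'\in S,\ (\Gamma,s',f')\models\varphi\}$. A formula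 is satisfiable relative to $\mathbf{MCM}$ if it is true at some $(\Gamma,s,f)$ with $s\in S$, $f\in\Phi$. *)

theory Defs
  imports Main "HOL-Library.FuncSet" "HOL-Library.Countable_Set" "HOL-Library.Nat_Bijection"
begin

section \<open>Language\<close>

datatype (atoms: 'a, outputs: 'v) fm =
    Atom 'a
  | Dec 'v
  | Neg "('a, 'v) fm"
  | Conj "('a, 'v) fm" "('a, 'v) fm"
  | BoxI "('a, 'v) fm"
  | BoxF "('a, 'v) fm"
  | Dyn "('a, 'v) fm" "('a, 'v) fm"

definition L_dyn :: "'a set \<Rightarrow> 'v set \<Rightarrow> ('a, 'v) fm set" where
  "L_dyn Atm Val = {\<phi>. atoms \<phi> \<subseteq> Atm \<and> outputs \<phi> \<subseteq> Val}"


section \<open>Multi-classifier models\<close>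

type_synonym ('a, 'v) mcm = "'a set set \<times> ('a set \<Rightarrow> 'v) set"

text \<open>A function from \<open>S\<close> to \<open>Val\<close> is an element of the extensional function space, so that
  classifiers are identified exactly when they agree on \<open>S\<close>.\<close>

definition MCM :: "'a set \<Rightarrow> 'v set \<Rightarrow> ('a, 'v) mcm set" where
  "MCM Atm Val = {(S, \<Phi>). S \<subseteq> Pow Atm \<and> \<Phi> \<subseteq> (S \<rightarrow>\<^sub>E Val)}"

text \<open>\<open>P\<close> is the truth set of the announced formula in \<open>\<Gamma>\<close>.\<close>

definition update :: "('a, 'v) mcm \<Rightarrow> ('a set \<Rightarrow> ('a set \<Rightarrow> 'v) \<Rightarrow> bool) \<Rightarrow> ('a, 'v) mcm" where
  "update \<Gamma> P = (fst \<Gamma>, {f' \<in> snd \<Gamma>. \<forall>s' \<in> fst \<Gamma>. P s' f'})"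

primrec holds :: "('a, 'v) fm \<Rightarrow> ('a, 'v) mcm \<Rightarrow> 'a set \<Rightarrow> ('a set \<Rightarrow> 'v) \<Rightarrow> bool" where
  "holds (Atom p) \<Gamma> s f \<longleftrightarrow> p \<in> s"
| "holds (Dec x) \<Gamma> s f \<longleftrightarrow> f s = x"
| "holds (Neg \<phi>) \<Gamma> s f \<longleftrightarrow> \<not> holds \<phi> \<Gamma> s f"
| "holds (Conj \<phi> \<psi>) \<Gamma> s f \<longleftrightarrow> holds \<phi> \<Gamma> s f \<and> holds \<psi> \<Gamma> s f"
| "holds (BoxI \<phi>) \<Gamma> s f \<longleftrightarrow> (\<forall>s' \<in> fst \<Gamma>. holds \<phi> \<Gamma> s' f)"
| "holds (BoxF \<phi>) \<Gamma> s f \<longleftrightarrow> (\<forall>f' \<in> snd \<Gamma>. holds \<phi> \<Gamma> s f')"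
| "holds (Dyn \<phi> \<psi>) \<Gamma> s f \<longleftrightarrow>
     ((\<forall>s' \<in> fst \<Gamma>. holds \<phi> \<Gamma> s' f) \<longrightarrow> holds \<psi> (update \<Gamma> (holds \<phi> \<Gamma>)) s f)"

definition satisfiable :: "'a set \<Rightarrow> 'v set \<Rightarrow> ('a, 'v) fm \<Rightarrow> bool" where
  "satisfiable Atm Val \<phi> \<longleftrightarrow>
     (\<exists>\<Gamma> \<in> MCM Atm Val. \<exists>s \<in> fst \<Gamma>. \<exists>f \<in> snd \<Gamma>. holds \<phi> \<Gamma> s f)"


section \<open>Decidability\<close>

text \<open>The total recursive functions: the least class containing the zero, successor and projection
  functions and closed under composition, primitive recursion and minimisation of regular functions.
  \<open>recursive n f\<close> concerns only the restriction of \<open>f\<close> to argument lists of length \<open>n\<close>;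
  the value of \<open>f\<close> on lists of any other length is irrelevant.\<close>

inductive recursive :: "nat \<Rightarrow> (nat list \<Rightarrow> nat) \<Rightarrow> bool" where
  zero: "recursive n (\<lambda>_. 0)"
| succ: "recursive 1 (\<lambda>xs. Suc (hd xs))"
| proj: "i < n \<Longrightarrow> recursive n (\<lambda>xs. xs ! i)"
| comp: "recursive (length gs) f \<Longrightarrow> (\<And>g. g \<in> set gs \<Longrightarrow> recursive n g) \<Longrightarrow>
    recursive n (\<lambda>xs. f (map (\<lambda>g. g xs) gs))"
| prec: "recursive n f \<Longrightarrow> recursive (Suc (Suc n)) g \<Longrightarrow>
    recursive (Suc n) (\<lambda>xs. rec_nat (f (tl xs)) (\<lambda>y r. g (y # r # tl xs)) (hd xs))"
| mini: "recursive (Suc n) f \<Longrightarrow> (\<And>xs. length xs = n \<Longrightarrow> \<exists>y. f (y # xs) = 0) \<Longrightarrow>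
    recursive n (\<lambda>xs. LEAST y. f (y # xs) = 0)"

definition decidable_set :: "nat set \<Rightarrow> bool" where
  "decidable_set A \<longleftrightarrow> (\<exists>d. recursive 1 d \<and> (\<forall>n. d [n] = (if n \<in> A then 1 else 0)))"

text \<open>Formulas are presented to the decision procedure by their codes. The library's
  \<open>to_nat_on A\<close> is a bijection from \<open>A\<close> onto \<open>{..<card A}\<close> if \<open>A\<close> is
  finite and onto all of \<open>nat\<close> if \<open>A\<close> is countably infinite, so it provides the
  usual enumeration of the symbols.\<close>

primrec code :: "'a set \<Rightarrow> 'v set \<Rightarrow> ('a, 'v) fm \<Rightarrow> nat" where
  "code Atm Val (Atom p) = prod_encode (0, to_nat_on Atm p)"
| "code Atm Val (Dec x) = prod_encode (1, to_nat_on Val x)"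
| "code Atm Val (Neg \<phi>) = prod_encode (2, code Atm Val \<phi>)"
| "code Atm Val (Conj \<phi> \<psi>) = prod_encode (3, prod_encode (code Atm Val \<phi>, code Atm Val \<psi>))"
| "code Atm Val (BoxI \<phi>) = prod_encode (4, code Atm Val \<phi>)"
| "code Atm Val (BoxF \<phi>) = prod_encode (5, code Atm Val \<phi>)"
| "code Atm Val (Dyn \<phi> \<psi>) = prod_encode (6, prod_encode (code Atm Val \<phi>, code Atm Val \<psi>))"

lemma inj_on_code:
  assumes "countable Atm" "countable Val"
  shows "inj_on (code Atm Val) (L_dyn Atm Val)"
proof -
  have "code Atm Val \<phi> = code Atm Val \<psi> \<Longrightarrow> \<phi> \<in> L_dyn Atm Val \<Longrightarrow> \<psi> \<in> L_dyn Atm Val \<Longrightarrow> \<phi> = \<psi>"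
    for \<phi> \<psi>
    by (induction \<phi> arbitrary: \<psi>; case_tac \<psi>) (auto simp: L_dyn_def assms)
  then show ?thesis by (auto intro: inj_onI)
qed

end

theory Submission
  imports Defs
begin

text \<open>Filtration gives models of computably bounded size. Label each row \<open>s\<close> of a model by the atoms of
  small index in \<open>s\<close> and the \<open>\<box>\<^sub>F\<close>-subformulas true at it, and each column \<open>f\<close> by the
  \<open>\<box>\<^sub>I\<close>-subformulas and announcements true at it, every subformula being evaluated in the update in which
  it occurs. The new model has \<open>K = card Val\<close> copies of every row label and of every column label, and
  copies \<open>k\<close> and \<open>j\<close> of two labels get the output with number \<open>(k + j) mod K\<close> in a cyclic enumeration of
  the outputs that occur between these labels; so each of these outputs occurs in every copy. If
  \<open>Atm\<close> is infinite, unused atoms distinguish the new rows, and if \<open>Atm\<close> is finite, there are only finitely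
  many models anyway. Finite models are coded by numbers, and a truth table of the subformulas over all
  updates of a model is characterised by bounded quantifiers, hence it is found by unbounded search.\<close>

section \<open>Closure properties of the recursive functions\<close>

text \<open>Agreement on lists of length \<open>n\<close> is built in, so that expressions may be
  rewritten by \<open>rc_cong\<close> as soon as they are equal on lists of the right
  length.\<close>

definition rc :: "nat \<Rightarrow> (nat list \<Rightarrow> nat) \<Rightarrow> bool" where
  "rc n f \<longleftrightarrow> (\<exists>g. recursive n g \<and> (\<forall>xs. length xs = n \<longrightarrow> g xs = f xs))"

definition pr :: "nat \<Rightarrow> (nat list \<Rightarrow> bool) \<Rightarrow> bool" where
  "pr n P \<longleftrightarrow> rc n (\<lambda>xs. if P xs then 1 else 0)"

lemma rc_cong: "rc n f \<Longrightarrow> (\<And>xs. length xs = n \<Longrightarrow> f xs = g xs) \<Longrightarrow> rc n g"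
  unfolding rc_def by metis

lemma pr_cong: "pr n P \<Longrightarrow> (\<And>xs. length xs = n \<Longrightarrow> P xs = Q xs) \<Longrightarrow> pr n Q"
  unfolding pr_def by (erule rc_cong) simp

lemma rc_comp:
  assumes f: "rc (length gs) f" and gs: "\<And>g. g \<in> set gs \<Longrightarrow> rc n g"
  shows "rc n (\<lambda>xs. f (map (\<lambda>g. g xs) gs))"
proof -
  obtain f' where f': "recursive (length gs) f'" "\<And>xs. length xs = length gs \<Longrightarrow> f' xs = f xs"
    using f unfolding rc_def by blast
  have "\<forall>g\<in>set gs. \<exists>g'. recursive n g' \<and> (\<forall>xs. length xs = n \<longrightarrow> g' xs = g xs)"
    using gs unfolding rc_def by blast
  then obtain h where h: "\<And>g. g \<in> set gs \<Longrightarrow> recursive n (h g)"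
    "\<And>g xs. g \<in> set gs \<Longrightarrow> length xs = n \<Longrightarrow> h g xs = g xs"
    by (metis (no_types))
  have "recursive n (\<lambda>xs. f' (map (\<lambda>g. g xs) (map h gs)))"
    by (rule recursive.comp) (use f' h in auto)
  moreover have "f' (map (\<lambda>g. g xs) (map h gs)) = f (map (\<lambda>g. g xs) gs)" if "length xs = n" for xs
  proof -
    have "map (\<lambda>g. g xs) (map h gs) = map (\<lambda>g. g xs) gs" using h that by simp
    then show ?thesis using f'(2)[of "map (\<lambda>g. g xs) gs"] by (simp del: map_map)
  qed
  ultimately show ?thesis unfolding rc_def by blast
qed

lemma rc_nth: "i < n \<Longrightarrow> rc n (\<lambda>xs. xs ! i)"
  unfolding rc_def using recursive.proj by blast

lemma rc_var0: "0 < n \<Longrightarrow> rc n hd"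
  by (rule rc_cong[OF rc_nth]) (auto simp: hd_conv_nth)

lemma rc_tl: "rc n f \<Longrightarrow> rc (Suc n) (\<lambda>xs. f (tl xs))"
proof (rule rc_cong)
  assume "rc n f"
  then show "rc (Suc n) (\<lambda>xs. f (map (\<lambda>g. g xs) (map (\<lambda>i xs. xs ! Suc i) [0..<n])))"
    by (intro rc_comp) (auto intro: rc_nth)
  fix xs :: "nat list" assume "length xs = Suc n"
  then have "map (\<lambda>g. g xs) (map (\<lambda>i xs. xs ! Suc i) [0..<n]) = tl xs"
    by (cases xs) (auto intro: nth_equalityI)
  then show "f (map (\<lambda>g. g xs) (map (\<lambda>i xs. xs ! Suc i) [0..<n])) = f (tl xs)" by simp
qed

lemma rc_var_Suc: "rc (n - 1) f \<Longrightarrow> 0 < n \<Longrightarrow> rc n (\<lambda>xs. f (tl xs))"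
  using rc_tl[of "n - 1" f] by simp

lemma rc_var1: "1 < n \<Longrightarrow> rc n (\<lambda>xs. hd (tl xs))"
  by (rule rc_var_Suc) (auto intro: rc_var0)
lemma rc_var2: "2 < n \<Longrightarrow> rc n (\<lambda>xs. hd (tl (tl xs)))"
  by (rule rc_var_Suc) (auto intro: rc_var1)
lemma rc_var3: "3 < n \<Longrightarrow> rc n (\<lambda>xs. hd (tl (tl (tl xs))))"
  by (rule rc_var_Suc) (auto intro: rc_var2)
lemma rc_var4: "4 < n \<Longrightarrow> rc n (\<lambda>xs. hd (tl (tl (tl (tl xs)))))"
  by (rule rc_var_Suc) (auto intro: rc_var3)
lemma rc_var5: "5 < n \<Longrightarrow> rc n (\<lambda>xs. hd (tl (tl (tl (tl (tl xs))))))"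
  by (rule rc_var_Suc) (auto intro: rc_var4)
lemma rc_var6: "6 < n \<Longrightarrow> rc n (\<lambda>xs. hd (tl (tl (tl (tl (tl (tl xs)))))))"
  by (rule rc_var_Suc) (auto intro: rc_var5)
lemma rc_var7: "7 < n \<Longrightarrow> rc n (\<lambda>xs. hd (tl (tl (tl (tl (tl (tl (tl xs))))))))"
  by (rule rc_var_Suc) (auto intro: rc_var6)
lemma rc_var8: "8 < n \<Longrightarrow> rc n (\<lambda>xs. hd (tl (tl (tl (tl (tl (tl (tl (tl xs)))))))))"
  by (rule rc_var_Suc) (auto intro: rc_var7)
lemma rc_var9: "9 < n \<Longrightarrow> rc n (\<lambda>xs. hd (tl (tl (tl (tl (tl (tl (tl (tl (tl xs))))))))))"
  by (rule rc_var_Suc) (auto intro: rc_var8)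
lemma rc_var10: "10 < n \<Longrightarrow> rc n (\<lambda>xs. hd (tl (tl (tl (tl (tl (tl (tl (tl (tl (tl xs)))))))))))"
  by (rule rc_var_Suc) (auto intro: rc_var9)

lemmas rc_vars = rc_var0 rc_var1 rc_var2 rc_var3 rc_var4 rc_var5 rc_var6 rc_var7 rc_var8 rc_var9
  rc_var10

lemma rc_push:
  assumes "rc (Suc n) F" "rc n b"
  shows "rc n (\<lambda>xs. F (b xs # xs))"
proof (rule rc_cong)
  show "rc n (\<lambda>xs. F (map (\<lambda>g. g xs) (b # map (\<lambda>i xs. xs ! i) [0..<n])))"
    using assms by (intro rc_comp) (auto intro: rc_nth)
  fix xs :: "nat list" assume "length xs = n"
  then have "map (\<lambda>g. g xs) (map (\<lambda>i xs. xs ! i) [0..<n]) = xs"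
    by (auto intro: nth_equalityI)
  then show "F (map (\<lambda>g. g xs) (b # map (\<lambda>i xs. xs ! i) [0..<n])) = F (b xs # xs)" by simp
qed

lemma rc_Suc: "rc n f \<Longrightarrow> rc n (\<lambda>xs. Suc (f xs))"
proof (rule rc_cong)
  have "rc 1 (\<lambda>xs. Suc (hd xs))" unfolding rc_def using recursive.succ by blast
  then show "rc n f \<Longrightarrow> rc n (\<lambda>xs. Suc (hd (map (\<lambda>g. g xs) [f])))"
    by (intro rc_comp[where gs = "[f]" and f = "\<lambda>xs. Suc (hd xs)"]) auto
qed simp

lemma rc_const: "rc n (\<lambda>_. c)"
proof (induction c)
  case 0
  show ?case unfolding rc_def using recursive.zero by blast
qed (rule rc_Suc)

text \<open>\<open>prec\<close> recurses on the head with the tail as parameters; pushing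
  \<open>b xs\<close> onto \<open>xs\<close> makes the number of iterations any recursive function
  of the parameters.\<close>

lemma rc_rec:
  assumes a: "rc n a" and b: "rc n b"
    and G: "rc (Suc (Suc n)) (\<lambda>zs. G (hd zs) (hd (tl zs)) (tl (tl zs)))"
  shows "rc n (\<lambda>xs. rec_nat (a xs) (\<lambda>y r. G y r xs) (b xs))"
proof -
  obtain a' where a': "recursive n a'" "\<And>xs. length xs = n \<Longrightarrow> a' xs = a xs"
    using a unfolding rc_def by blast
  obtain g where g: "recursive (Suc (Suc n)) g"
    "\<And>xs. length xs = Suc (Suc n) \<Longrightarrow> g xs = G (hd xs) (hd (tl xs)) (tl (tl xs))"
    using G unfolding rc_def by blast
  have "rc (Suc n) (\<lambda>xs. rec_nat (a' (tl xs)) (\<lambda>y r. g (y # r # tl xs)) (hd xs))"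
    unfolding rc_def using recursive.prec[OF a'(1) g(1)] by blast
  from rc_push[OF this b] show ?thesis
    by (rule rc_cong) (simp add: a' g)
qed

section \<open>Arithmetic, Boolean operations and search\<close>

lemma rc_add: "rc n f \<Longrightarrow> rc n g \<Longrightarrow> rc n (\<lambda>xs. f xs + g xs)"
proof (rule rc_cong)
  show "rc n f \<Longrightarrow> rc n g \<Longrightarrow> rc n (\<lambda>xs. rec_nat (f xs) (\<lambda>y r. Suc r) (g xs))"
    by (intro rc_rec rc_Suc rc_vars; simp)
  have "rec_nat a (\<lambda>y r. Suc r) b = a + b" for a b :: nat by (induction b) simp_all
  then show "rec_nat (f xs) (\<lambda>y r. Suc r) (g xs) = f xs + g xs" for xs .
qed

lemma rc_mult: "rc n f \<Longrightarrow> rc n g \<Longrightarrow> rc n (\<lambda>xs. f xs * g xs)"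
proof (rule rc_cong)
  show "rc n f \<Longrightarrow> rc n g \<Longrightarrow> rc n (\<lambda>xs. rec_nat 0 (\<lambda>y r. r + f xs) (g xs))"
    by (intro rc_rec rc_add rc_const rc_tl rc_vars; simp)
  have "rec_nat 0 (\<lambda>y r. r + a) b = a * b" for a b :: nat by (induction b) simp_all
  then show "rec_nat 0 (\<lambda>y r. r + f xs) (g xs) = f xs * g xs" for xs .
qed

lemma rc_power: "rc n f \<Longrightarrow> rc n g \<Longrightarrow> rc n (\<lambda>xs. f xs ^ g xs)"
proof (rule rc_cong)
  show "rc n f \<Longrightarrow> rc n g \<Longrightarrow> rc n (\<lambda>xs. rec_nat 1 (\<lambda>y r. r * f xs) (g xs))"
    by (intro rc_rec rc_mult rc_const rc_tl rc_vars; simp)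
  have "rec_nat 1 (\<lambda>y r. r * a) b = a ^ b" for a b :: nat by (induction b) simp_all
  then show "rec_nat 1 (\<lambda>y r. r * f xs) (g xs) = f xs ^ g xs" for xs .
qed

lemma rc_pred: "rc n f \<Longrightarrow> rc n (\<lambda>xs. f xs - 1)"
proof (rule rc_cong)
  show "rc n f \<Longrightarrow> rc n (\<lambda>xs. rec_nat 0 (\<lambda>y r. y) (f xs))"
    by (intro rc_rec rc_const rc_vars; simp)
  show "rec_nat 0 (\<lambda>y r. y) (f xs) = f xs - 1" for xs by (cases "f xs") simp_all
qed

lemma rc_diff: "rc n f \<Longrightarrow> rc n g \<Longrightarrow> rc n (\<lambda>xs. f xs - g xs)"
proof (rule rc_cong)
  show "rc n f \<Longrightarrow> rc n g \<Longrightarrow> rc n (\<lambda>xs. rec_nat (f xs) (\<lambda>y r. r - 1) (g xs))"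
    by (intro rc_rec rc_pred rc_vars; simp)
  have "rec_nat a (\<lambda>y r. r - 1) b = a - b" for a b :: nat by (induction b) simp_all
  then show "rec_nat (f xs) (\<lambda>y r. r - 1) (g xs) = f xs - g xs" for xs .
qed

lemma pr_le: "rc n f \<Longrightarrow> rc n g \<Longrightarrow> pr n (\<lambda>xs. f xs \<le> g xs)"
  unfolding pr_def by (rule rc_cong[of _ "\<lambda>xs. 1 - (f xs - g xs)"])
    (auto intro!: rc_diff rc_const)

lemma pr_less: "rc n f \<Longrightarrow> rc n g \<Longrightarrow> pr n (\<lambda>xs. f xs < g xs)"
  unfolding less_eq_Suc_le by (intro pr_le rc_Suc)

lemma pr_not: "pr n P \<Longrightarrow> pr n (\<lambda>xs. \<not> P xs)"
  unfolding pr_def by (rule rc_cong[of _ "\<lambda>xs. 1 - (if P xs then 1 else 0)"])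
    (auto intro!: rc_diff rc_const)

lemma pr_conj: "pr n P \<Longrightarrow> pr n Q \<Longrightarrow> pr n (\<lambda>xs. P xs \<and> Q xs)"
  unfolding pr_def
  by (rule rc_cong[of _ "\<lambda>xs. (if P xs then 1 else 0) * (if Q xs then 1 else 0)"])
    (auto intro!: rc_mult)

lemma pr_disj: "pr n P \<Longrightarrow> pr n Q \<Longrightarrow> pr n (\<lambda>xs. P xs \<or> Q xs)"
  by (rule pr_cong[of _ "\<lambda>xs. \<not> (\<not> P xs \<and> \<not> Q xs)"], intro pr_not pr_conj) auto

lemma pr_imp: "pr n P \<Longrightarrow> pr n Q \<Longrightarrow> pr n (\<lambda>xs. P xs \<longrightarrow> Q xs)"
  by (rule pr_cong[of _ "\<lambda>xs. \<not> P xs \<or> Q xs"], intro pr_not pr_disj) auto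

lemma pr_iff: "pr n P \<Longrightarrow> pr n Q \<Longrightarrow> pr n (\<lambda>xs. P xs \<longleftrightarrow> Q xs)"
  by (rule pr_cong[of _ "\<lambda>xs. (P xs \<longrightarrow> Q xs) \<and> (Q xs \<longrightarrow> P xs)"], intro pr_imp pr_conj) auto

lemma pr_eq: "rc n f \<Longrightarrow> rc n g \<Longrightarrow> pr n (\<lambda>xs. f xs = g xs)"
  by (rule pr_cong[of _ "\<lambda>xs. f xs \<le> g xs \<and> g xs \<le> f xs"], intro pr_conj pr_le) auto

lemma pr_const: "pr n (\<lambda>_. b)"
  unfolding pr_def by (rule rc_const)

text \<open>Under a quantifier the bound variable is pushed onto the argument list, so the variables of
  an argument list are addressed as \<open>hd xs\<close>, \<open>hd (tl xs)\<close>, and so on.\<close>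

lemma pr_all_less:
  assumes P: "pr (Suc n) (\<lambda>zs. P (hd zs) (tl zs))" and b: "rc n b"
  shows "pr n (\<lambda>xs. \<forall>y<b xs. P y xs)"
  unfolding pr_def
proof (rule rc_cong)
  \<comment> \<open>The recursion step receives counter, accumulator and parameters, while
    \<open>P\<close> takes only counter and parameters; projections skip the accumulator.\<close>
  have "rc (Suc (Suc n)) (\<lambda>zs. (\<lambda>ys. if P (hd ys) (tl ys) then 1 else 0) (hd zs # tl (tl zs)))"
  proof (rule rc_cong)
    show "rc (Suc (Suc n)) (\<lambda>zs. (\<lambda>ys. if P (hd ys) (tl ys) then 1 else 0)
            (map (\<lambda>g. g zs) (hd # map (\<lambda>i xs. xs ! Suc (Suc i)) [0..<n])))"
      using P unfolding pr_def by (intro rc_comp) (auto intro: rc_nth rc_var0)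
    fix zs :: "nat list" assume "length zs = Suc (Suc n)"
    then have "map (\<lambda>g. g zs) (map (\<lambda>i xs. xs ! Suc (Suc i)) [0..<n]) = tl (tl zs)"
      by (auto intro!: nth_equalityI simp: nth_tl)
    then show "(\<lambda>ys. if P (hd ys) (tl ys) then 1 else 0)
            (map (\<lambda>g. g zs) (hd # map (\<lambda>i xs. xs ! Suc (Suc i)) [0..<n]))
          = (\<lambda>ys. if P (hd ys) (tl ys) then 1 else 0 :: nat) (hd zs # tl (tl zs))"
      by (simp del: map_map)
  qed
  then show "rc n (\<lambda>xs. rec_nat 1 (\<lambda>y r. r * (if P y xs then 1 else 0)) (b xs))"
    by (intro rc_rec rc_mult rc_const b rc_vars) simp_all
  have "rec_nat 1 (\<lambda>y r. r * (if P y xs then 1 else 0)) m = (if \<forall>y<m. P y xs then 1 else 0 :: nat)"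
    for m xs by (induction m) (auto simp: less_Suc_eq)
  then show "rec_nat 1 (\<lambda>y r. r * (if P y xs then 1 else 0)) (b xs)
      = (if \<forall>y<b xs. P y xs then 1 else 0 :: nat)" for xs .
qed

lemma pr_ex_less:
  assumes P: "pr (Suc n) (\<lambda>zs. P (hd zs) (tl zs))" and b: "rc n b"
  shows "pr n (\<lambda>xs. \<exists>y<b xs. P y xs)"
  by (rule pr_cong[of _ "\<lambda>xs. \<not> (\<forall>y<b xs. \<not> P y xs)"], intro pr_not pr_all_less assms) auto

lemma pr_all_le:
  assumes P: "pr (Suc n) (\<lambda>zs. P (hd zs) (tl zs))" and b: "rc n b"
  shows "pr n (\<lambda>xs. \<forall>y\<le>b xs. P y xs)"
  by (rule pr_cong[of _ "\<lambda>xs. \<forall>y<Suc (b xs). P y xs"],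
      intro pr_all_less assms rc_Suc) (auto simp: less_Suc_eq_le)

lemma pr_ex_le:
  assumes P: "pr (Suc n) (\<lambda>zs. P (hd zs) (tl zs))" and b: "rc n b"
  shows "pr n (\<lambda>xs. \<exists>y\<le>b xs. P y xs)"
  by (rule pr_cong[of _ "\<lambda>xs. \<exists>y<Suc (b xs). P y xs"],
      intro pr_ex_less assms rc_Suc) (auto simp: less_Suc_eq_le)

lemma rc_Least:
  assumes P: "pr (Suc n) (\<lambda>zs. P (hd zs) (tl zs))"
    and ex: "\<And>xs. length xs = n \<Longrightarrow> \<exists>y. P y xs"
  shows "rc n (\<lambda>xs. LEAST y. P y xs)"
proof -
  \<comment> \<open>Minimisation searches for a zero, hence the characteristic function of the
    negation; \<open>ex\<close> supplies the regularity that \<open>mini\<close> demands.\<close>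
  from pr_not[OF P] obtain f where f: "recursive (Suc n) f"
    "\<And>zs. length zs = Suc n \<Longrightarrow> f zs = (if \<not> P (hd zs) (tl zs) then 1 else 0)"
    unfolding pr_def rc_def by blast
  have "recursive n (\<lambda>xs. LEAST y. f (y # xs) = 0)"
  proof (rule recursive.mini[OF f(1)])
    fix xs :: "nat list" assume "length xs = n"
    then show "\<exists>y. f (y # xs) = 0" using ex[of xs] f(2)[of "_ # xs"] by force
  qed
  then show ?thesis unfolding rc_def
    by (intro exI[of _ "\<lambda>xs. LEAST y. f (y # xs) = 0"]) (simp add: f)
qed

lemma pr_subst1:
  assumes "pr 1 (\<lambda>xs. P (hd xs))" "rc n f"
  shows "pr n (\<lambda>xs. P (f xs))"
  using rc_comp[of "[f]" "\<lambda>xs. if P (hd xs) then 1 else 0" n] assms unfolding pr_def by auto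

lemma rc_subst1:
  assumes "rc 1 (\<lambda>xs. F (hd xs))" "rc n f"
  shows "rc n (\<lambda>xs. F (f xs))"
  using rc_comp[of "[f]" "\<lambda>xs. F (hd xs)" n] assms by auto

lemma rc_subst2:
  assumes "rc 2 (\<lambda>xs. F (hd xs) (hd (tl xs)))" "rc n f" "rc n g"
  shows "rc n (\<lambda>xs. F (f xs) (g xs))"
  using rc_comp[of "[f, g]" "\<lambda>xs. F (hd xs) (hd (tl xs))" n] assms by (auto simp: numeral_2_eq_2)

lemma rc_subst3:
  assumes "rc 3 (\<lambda>xs. F (hd xs) (hd (tl xs)) (hd (tl (tl xs))))" "rc n f" "rc n g" "rc n h"
  shows "rc n (\<lambda>xs. F (f xs) (g xs) (h xs))"
  using rc_comp[of "[f, g, h]" "\<lambda>xs. F (hd xs) (hd (tl xs)) (hd (tl (tl xs)))" n] assms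
  by (auto simp: numeral_3_eq_3)

lemmas rc_intros = rc_vars rc_Suc rc_const rc_add rc_mult rc_power rc_diff
lemmas pr_intros = pr_le pr_less pr_eq pr_not pr_conj pr_disj pr_imp pr_iff pr_const
  pr_all_less pr_ex_less pr_all_le pr_ex_le

section \<open>Division, binary digits and pairing\<close>

lemma rc_div: "rc n f \<Longrightarrow> rc n g \<Longrightarrow> rc n (\<lambda>xs. f xs div g xs)"
proof (rule rc_subst2[where F = "(div)"])
  \<comment> \<open>For \<open>y > 0\<close> the quotient is the least \<open>q\<close> with
    \<open>x < Suc q * y\<close>; the second disjunct stops the search at 0 when
    \<open>y = 0\<close>, in accordance with \<open>x div 0 = 0\<close>.\<close>
  have *: "(LEAST q. x < Suc q * y \<or> y = 0) = x div y" for x y :: nat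
  proof (cases "y = 0")
    case False
    show ?thesis
    proof (rule Least_equality)
      show "x < Suc (x div y) * y \<or> y = 0" using False dividend_less_div_times[of y x] by simp
      show "x div y \<le> q" if "x < Suc q * y \<or> y = 0" for q
        using that False less_mult_imp_div_less[of x "Suc q" y] by simp
    qed
  qed (simp add: Least_eq_0)
  have "rc 2 (\<lambda>xs. LEAST q. hd xs < Suc q * hd (tl xs) \<or> hd (tl xs) = 0)"
  proof (rule rc_Least)
    show "pr (Suc 2) (\<lambda>zs. hd (tl zs) < Suc (hd zs) * hd (tl (tl zs)) \<or> hd (tl (tl zs)) = 0)"
      by (intro pr_intros rc_intros; simp)
    show "\<exists>q. hd xs < Suc q * hd (tl xs) \<or> hd (tl xs) = 0" for xs :: "nat list"
      by (rule exI[of _ "hd xs"]) (cases "hd (tl xs)"; simp)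
  qed
  then show "rc 2 (\<lambda>xs. hd xs div hd (tl xs))" unfolding * .
qed

lemma rc_mod: "rc n f \<Longrightarrow> rc n g \<Longrightarrow> rc n (\<lambda>xs. f xs mod g xs)"
  unfolding modulo_nat_def by (intro rc_intros rc_div)

lemma pr_set_decode: "rc n f \<Longrightarrow> rc n g \<Longrightarrow> pr n (\<lambda>xs. g xs \<in> set_decode (f xs))"
  unfolding set_decode_def mem_Collect_eq odd_iff_mod_2_eq_one
  by (intro pr_intros rc_intros rc_mod rc_div)

lemma rc_prod_encode: "rc n f \<Longrightarrow> rc n g \<Longrightarrow> rc n (\<lambda>xs. prod_encode (f xs, g xs))"
  unfolding prod_encode_def triangle_def split by (intro rc_intros rc_div)

text \<open>A component is bounded by the code of the pair, so the second one can be quantified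
  boundedly while the first is searched for.\<close>

lemma rc_prod_decode_fst: "rc n f \<Longrightarrow> rc n (\<lambda>xs. fst (prod_decode (f xs)))"
proof (rule rc_subst1[where F = "\<lambda>z. fst (prod_decode z)"])
  have *: "(LEAST a. \<exists>b\<le>z. prod_encode (a, b) = z) = fst (prod_decode z)" for z
  proof (rule Least_equality)
    show "\<exists>b\<le>z. prod_encode (fst (prod_decode z), b) = z"
      by (rule exI[of _ "snd (prod_decode z)"]) (metis le_prod_encode_2 prod_decode_inverse prod.collapse)
  qed (metis fst_conv prod_encode_inverse order_refl)
  have "rc 1 (\<lambda>xs. LEAST a. \<exists>b\<le>hd xs. prod_encode (a, b) = hd xs)"
  proof (rule rc_Least)
    show "pr (Suc 1) (\<lambda>zs. \<exists>b\<le>hd (tl zs). prod_encode (hd zs, b) = hd (tl zs))"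
      by (intro pr_intros rc_intros rc_prod_encode; simp)
    show "\<exists>a. \<exists>b\<le>hd xs. prod_encode (a, b) = hd xs" for xs :: "nat list"
      by (metis le_prod_encode_2 prod_decode_inverse prod.collapse)
  qed
  then show "rc 1 (\<lambda>xs. fst (prod_decode (hd xs)))" unfolding * .
qed

lemma rc_prod_decode_snd: "rc n f \<Longrightarrow> rc n (\<lambda>xs. snd (prod_decode (f xs)))"
proof (rule rc_subst1[where F = "\<lambda>z. snd (prod_decode z)"])
  have *: "(LEAST b. prod_encode (fst (prod_decode z), b) = z) = snd (prod_decode z)" for z
  proof (rule Least_equality)
    show "prod_encode (fst (prod_decode z), snd (prod_decode z)) = z"
      by (metis prod_decode_inverse prod.collapse)
  qed (metis snd_conv prod_encode_inverse order_refl)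
  have "rc 1 (\<lambda>xs. LEAST b. prod_encode (fst (prod_decode (hd xs)), b) = hd xs)"
  proof (rule rc_Least)
    show "pr (Suc 1) (\<lambda>zs. prod_encode (fst (prod_decode (hd (tl zs))), hd zs) = hd (tl zs))"
      by (intro pr_intros rc_intros rc_prod_encode rc_prod_decode_fst; simp)
    show "\<exists>b. prod_encode (fst (prod_decode (hd xs)), b) = hd xs" for xs :: "nat list"
      by (metis prod_decode_inverse prod.collapse)
  qed
  then show "rc 1 (\<lambda>xs. snd (prod_decode (hd xs)))" unfolding * .
qed

lemmas recursive_intros = rc_intros rc_div rc_mod rc_prod_encode rc_prod_decode_fst
  rc_prod_decode_snd pr_intros pr_set_decode

section \<open>Matrix models\<close>

text \<open>Classifiers occur only as columns of the matrix \<open>T\<close>, so distinct columns may have equal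
  entries.\<close>

primrec gholds :: "('a, 'v) fm \<Rightarrow> ('r \<Rightarrow> 'a \<Rightarrow> bool) \<Rightarrow> ('r \<Rightarrow> 'c \<Rightarrow> 'v) \<Rightarrow> 'r set \<Rightarrow> 'c set \<Rightarrow> 'r \<Rightarrow> 'c \<Rightarrow> bool"
where
  "gholds (Atom p) V T R C s f \<longleftrightarrow> V s p"
| "gholds (Dec x) V T R C s f \<longleftrightarrow> T s f = x"
| "gholds (Neg \<phi>) V T R C s f \<longleftrightarrow> \<not> gholds \<phi> V T R C s f"
| "gholds (Conj \<phi> \<psi>) V T R C s f \<longleftrightarrow> gholds \<phi> V T R C s f \<and> gholds \<psi> V T R C s f"
| "gholds (BoxI \<phi>) V T R C s f \<longleftrightarrow> (\<forall>s'\<in>R. gholds \<phi> V T R C s' f)"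
| "gholds (BoxF \<phi>) V T R C s f \<longleftrightarrow> (\<forall>f'\<in>C. gholds \<phi> V T R C s f')"
| "gholds (Dyn \<phi> \<psi>) V T R C s f \<longleftrightarrow>
     ((\<forall>s'\<in>R. gholds \<phi> V T R C s' f) \<longrightarrow>
       gholds \<psi> V T R {f'\<in>C. \<forall>s'\<in>R. gholds \<phi> V T R C s' f'} s f)"

lemma holds_eq_gholds: "holds \<phi> (S, \<Phi>) s f = gholds \<phi> (\<lambda>s p. p \<in> s) (\<lambda>s f. f s) S \<Phi> s f"
  by (induction \<phi> arbitrary: \<Phi> s f) (simp_all add: update_def)

text \<open>Truth consults only the atoms of \<open>\<phi>\<close> and the matrix entries, so
  \<open>g\<close> and \<open>h\<close> may even identify rows or columns that look alike.\<close>

lemma gholds_image: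
  assumes "\<And>s p. s \<in> R \<Longrightarrow> p \<in> atoms \<phi> \<Longrightarrow> V' (g s) p = V s p"
    and "\<And>s f. s \<in> R \<Longrightarrow> f \<in> C \<Longrightarrow> T' (g s) (h f) = T s f"
    and "s \<in> R" "f \<in> C"
  shows "gholds \<phi> V' T' (g ` R) (h ` C) (g s) (h f) = gholds \<phi> V T R C s f"
  using assms
proof (induction \<phi> arbitrary: C s f)
  case (Dyn \<phi> \<psi>)
  let ?D = "{f\<in>C. \<forall>s'\<in>R. gholds \<phi> V T R C s' f}"
  have IH: "gholds \<phi> V' T' (g ` R) (h ` C) (g s) (h f) = gholds \<phi> V T R C s f"
    if "s \<in> R" "f \<in> C" for s f
    by (rule Dyn.IH(1)) (use Dyn.prems that in auto)
  \<comment> \<open>Survival of a column is decided by truth, which \<open>g\<close> and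
    \<open>h\<close> preserve; hence updating commutes with taking images.\<close>
  have upd: "{f'\<in>h ` C. \<forall>s'\<in>g ` R. gholds \<phi> V' T' (g ` R) (h ` C) s' f'} = h ` ?D"
    using IH by auto
  have "gholds \<psi> V' T' (g ` R) (h ` ?D) (g s) (h f) = gholds \<psi> V T R ?D s f" if "f \<in> ?D"
    by (rule Dyn.IH(2)) (use Dyn.prems that in auto)
  then show ?case using Dyn.prems IH unfolding gholds.simps upd by auto
qed auto

section \<open>Filtration through row and column labels\<close>

text \<open>A \<open>BoxF\<close> formula is constant along a row, so it defines a set of rows. The
  recursion shrinks \<open>C\<close> after an announcement as \<open>gholds\<close> does, so each
  set belongs to the update in which its subformula occurs.\<close>

primrec row_sets :: "('a, 'v) fm \<Rightarrow> ('r \<Rightarrow> 'a \<Rightarrow> bool) \<Rightarrow> ('r \<Rightarrow> 'c \<Rightarrow> 'v) \<Rightarrow> 'r set \<Rightarrow> 'c set \<Rightarrow> 'r set list"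
where
  "row_sets (Atom p) V T R C = []"
| "row_sets (Dec x) V T R C = []"
| "row_sets (Neg \<phi>) V T R C = row_sets \<phi> V T R C"
| "row_sets (Conj \<phi> \<psi>) V T R C = row_sets \<phi> V T R C @ row_sets \<psi> V T R C"
| "row_sets (BoxI \<phi>) V T R C = row_sets \<phi> V T R C"
| "row_sets (BoxF \<phi>) V T R C = {s. \<forall>f\<in>C. gholds \<phi> V T R C s f} # row_sets \<phi> V T R C"
| "row_sets (Dyn \<phi> \<psi>) V T R C =
     row_sets \<phi> V T R C @ row_sets \<psi> V T R {f\<in>C. \<forall>s\<in>R. gholds \<phi> V T R C s f}"

text \<open>Announcements contribute besides \<open>BoxI\<close> formulas: passing an announcement
  decides whether a column survives, so the label must record it.\<close>

primrec col_sets :: "('a, 'v) fm \<Rightarrow> ('r \<Rightarrow> 'a \<Rightarrow> bool) \<Rightarrow> ('r \<Rightarrow> 'c \<Rightarrow> 'v) \<Rightarrow> 'r set \<Rightarrow> 'c set \<Rightarrow> 'c set list"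
where
  "col_sets (Atom p) V T R C = []"
| "col_sets (Dec x) V T R C = []"
| "col_sets (Neg \<phi>) V T R C = col_sets \<phi> V T R C"
| "col_sets (Conj \<phi> \<psi>) V T R C = col_sets \<phi> V T R C @ col_sets \<psi> V T R C"
| "col_sets (BoxI \<phi>) V T R C = {f. \<forall>s\<in>R. gholds \<phi> V T R C s f} # col_sets \<phi> V T R C"
| "col_sets (BoxF \<phi>) V T R C = col_sets \<phi> V T R C"
| "col_sets (Dyn \<phi> \<psi>) V T R C = {f. \<forall>s\<in>R. gholds \<phi> V T R C s f} # col_sets \<phi> V T R C @
     col_sets \<psi> V T R {f\<in>C. \<forall>s\<in>R. gholds \<phi> V T R C s f}"

definition label_inv :: "('x \<Rightarrow> 'l) \<Rightarrow> 'x set \<Rightarrow> 'x set list \<Rightarrow> bool" where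
  "label_inv l A Xs \<longleftrightarrow> (\<forall>X\<in>set Xs. \<forall>x\<in>A. \<forall>y\<in>A. l x = l y \<longrightarrow> x \<in> X \<longrightarrow> y \<in> X)"

lemma label_inv_simps [simp]:
  "label_inv l A []"
  "label_inv l A (X # Xs) \<longleftrightarrow> (\<forall>x\<in>A. \<forall>y\<in>A. l x = l y \<longrightarrow> x \<in> X \<longrightarrow> y \<in> X) \<and> label_inv l A Xs"
  "label_inv l A (Xs @ Ys) \<longleftrightarrow> label_inv l A Xs \<and> label_inv l A Ys"
  by (auto simp: label_inv_def)

lemma label_inv_subset: "label_inv l A Xs \<Longrightarrow> B \<subseteq> A \<Longrightarrow> label_inv l B Xs"
  by (auto simp: label_inv_def)

text \<open>\<open>\<rho>\<close>, \<open>\<gamma>\<close> label the rows and columns of a model and \<open>\<rho>'\<close>, \<open>\<gamma>'\<close> those of a second model.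
  The second model realises exactly the triples (row label, column label, output) of the first,
  each of them in every row and in every column with the right label.\<close>

locale filtration =
  fixes V :: "'r \<Rightarrow> 'a \<Rightarrow> bool" and T :: "'r \<Rightarrow> 'c \<Rightarrow> 'v" and R :: "'r set"
    and \<rho> :: "'r \<Rightarrow> 'l" and \<gamma> :: "'c \<Rightarrow> 'm"
    and V' :: "'s \<Rightarrow> 'a \<Rightarrow> bool" and T' :: "'s \<Rightarrow> 'd \<Rightarrow> 'v" and R' :: "'s set"
    and \<rho>' :: "'s \<Rightarrow> 'l" and \<gamma>' :: "'d \<Rightarrow> 'm"
begin

text \<open>Back-and-forth conditions. The first clause pulls new cells back; the second stays in a
  given new column, as \<open>BoxI\<close> requires, and the third in a given new row, as
  \<open>BoxF\<close> requires.\<close>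

definition "realizes C C' \<longleftrightarrow>
  (\<forall>s'\<in>R'. \<forall>f'\<in>C'. \<exists>s\<in>R. \<exists>f\<in>C. \<rho> s = \<rho>' s' \<and> \<gamma> f = \<gamma>' f' \<and> T s f = T' s' f') \<and>
  (\<forall>s\<in>R. \<forall>f\<in>C. \<forall>f'\<in>C'. \<gamma> f = \<gamma>' f' \<longrightarrow> (\<exists>s'\<in>R'. \<rho> s = \<rho>' s' \<and> T s f = T' s' f')) \<and>
  (\<forall>s\<in>R. \<forall>f\<in>C. \<forall>s'\<in>R'. \<rho> s = \<rho>' s' \<longrightarrow> (\<exists>f'\<in>C'. \<gamma> f = \<gamma>' f' \<and> T s f = T' s' f'))"

definition "matches s f s' f' \<longleftrightarrow> \<rho> s = \<rho>' s' \<and> \<gamma> f = \<gamma>' f' \<and> T s f = T' s' f'"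

definition "agree p \<longleftrightarrow> (\<forall>s\<in>R. \<forall>s'\<in>R'. \<rho> s = \<rho>' s' \<longrightarrow> V' s' p = V s p)"

lemma realizes_back:
  assumes "realizes C C'" "s' \<in> R'" "f' \<in> C'"
  obtains s f where "s \<in> R" "f \<in> C" "matches s f s' f'"
  using assms unfolding realizes_def matches_def by meson

lemma realizes_row:
  assumes "realizes C C'" "s \<in> R" "f \<in> C" "f' \<in> C'" "\<gamma> f = \<gamma>' f'"
  obtains s' where "s' \<in> R'" "matches s f s' f'"
  using assms unfolding realizes_def matches_def by meson

lemma realizes_col:
  assumes "realizes C C'" "s \<in> R" "f \<in> C" "s' \<in> R'" "\<rho> s = \<rho>' s'"
  obtains f' where "f' \<in> C'" "matches s f s' f'"
  using assms unfolding realizes_def matches_def by meson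

text \<open>From left to right, the old cell supplied for \<open>t'\<close> and \<open>f'\<close>
  may lie in another column \<open>g\<close> than \<open>f\<close>; their labels agree, so
  \<open>inv\<close> bridges the two. From right to left, the new column contains a match for each
  old row.\<close>

lemma BoxI_transfer:
  assumes real: "realizes C C'"
    and inv: "\<And>f g. f \<in> C \<Longrightarrow> g \<in> C \<Longrightarrow> \<gamma> f = \<gamma> g \<Longrightarrow> \<forall>s\<in>R. P s f \<Longrightarrow> \<forall>s\<in>R. P s g"
    and IH: "\<And>s s' f f'. s \<in> R \<Longrightarrow> s' \<in> R' \<Longrightarrow> f \<in> C \<Longrightarrow> f' \<in> C' \<Longrightarrow> matches s f s' f' \<Longrightarrow> P s f = P' s' f'"
    and ff': "f \<in> C" "f' \<in> C'" "\<gamma> f = \<gamma>' f'"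
  shows "(\<forall>s\<in>R. P s f) \<longleftrightarrow> (\<forall>s'\<in>R'. P' s' f')"
proof (intro iffI ballI)
  fix t' assume *: "\<forall>s\<in>R. P s f" and t': "t' \<in> R'"
  obtain t g where tg: "t \<in> R" "g \<in> C" "matches t g t' f'"
    using realizes_back[OF real t' ff'(2)] .
  then have "\<forall>s\<in>R. P s g" using inv[of f g] ff' * by (simp add: matches_def)
  then show "P' t' f'" using IH[of t t' g f'] tg t' ff' by blast
next
  fix t assume *: "\<forall>s'\<in>R'. P' s' f'" and t: "t \<in> R"
  obtain t' where "t' \<in> R'" "matches t f t' f'"
    using realizes_row[OF real t ff'] .
  then show "P t f" using IH[of t t' f f'] t * ff' by blast
qed

text \<open>Dually, the pulled-back cell may lie in another row with the same label, and
  \<open>inv\<close> bridges the two rows.\<close>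

lemma BoxF_transfer:
  assumes real: "realizes C C'"
    and inv: "\<And>s t. s \<in> R \<Longrightarrow> t \<in> R \<Longrightarrow> \<rho> s = \<rho> t \<Longrightarrow> \<forall>f\<in>C. P s f \<Longrightarrow> \<forall>f\<in>C. P t f"
    and IH: "\<And>s s' f f'. s \<in> R \<Longrightarrow> s' \<in> R' \<Longrightarrow> f \<in> C \<Longrightarrow> f' \<in> C' \<Longrightarrow> matches s f s' f' \<Longrightarrow> P s f = P' s' f'"
    and ss': "s \<in> R" "s' \<in> R'" "\<rho> s = \<rho>' s'"
  shows "(\<forall>f\<in>C. P s f) \<longleftrightarrow> (\<forall>f'\<in>C'. P' s' f')"
proof (intro iffI ballI)
  fix g' assume *: "\<forall>f\<in>C. P s f" and g': "g' \<in> C'"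
  obtain t g where tg: "t \<in> R" "g \<in> C" "matches t g s' g'"
    using realizes_back[OF real ss'(2) g'] .
  then have "\<forall>f\<in>C. P t f" using inv[of s t] ss' * by (simp add: matches_def)
  then show "P' s' g'" using IH[of t s' g g'] tg g' ss' by blast
next
  fix g assume *: "\<forall>f'\<in>C'. P' s' f'" and g: "g \<in> C"
  obtain g' where "g' \<in> C'" "matches s g s' g'"
    using realizes_col[OF real ss'(1) g ss'(2,3)] .
  then show "P s g" using IH[of s s' g g'] g * ss' by blast
qed

text \<open>An announcement keeps or deletes matching columns alike, so realisation survives updates.\<close>

lemma realizes_update:
  assumes real: "realizes C C'"
    and inv: "\<And>f g. f \<in> C \<Longrightarrow> g \<in> C \<Longrightarrow> \<gamma> f = \<gamma> g \<Longrightarrow> A f \<Longrightarrow> A g"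
    and A: "\<And>f f'. f \<in> C \<Longrightarrow> f' \<in> C' \<Longrightarrow> \<gamma> f = \<gamma>' f' \<Longrightarrow> A f \<longleftrightarrow> A' f'"
  shows "realizes {f\<in>C. A f} {f'\<in>C'. A' f'}"
  unfolding realizes_def
proof (intro conjI ballI impI)
  fix s' f' assume *: "s' \<in> R'" "f' \<in> {f'\<in>C'. A' f'}"
  then obtain s f where "s \<in> R" "f \<in> C" "matches s f s' f'"
    using realizes_back[OF real, of s' f'] by auto
  then show "\<exists>s\<in>R. \<exists>f\<in>{f\<in>C. A f}. \<rho> s = \<rho>' s' \<and> \<gamma> f = \<gamma>' f' \<and> T s f = T' s' f'"
    using A[of f f'] * unfolding matches_def by auto
next
  fix s f f' assume *: "s \<in> R" "f \<in> {f\<in>C. A f}" "f' \<in> {f'\<in>C'. A' f'}" "\<gamma> f = \<gamma>' f'"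
  then obtain s' where "s' \<in> R'" "matches s f s' f'"
    using realizes_row[OF real, of s f f'] by auto
  then show "\<exists>s'\<in>R'. \<rho> s = \<rho>' s' \<and> T s f = T' s' f'" unfolding matches_def by blast
next
  fix s f s' assume *: "s \<in> R" "f \<in> {f\<in>C. A f}" "s' \<in> R'" "\<rho> s = \<rho>' s'"
  then obtain f' where "f' \<in> C'" "matches s f s' f'"
    using realizes_col[OF real, of s f s'] by auto
  then show "\<exists>f'\<in>{f'\<in>C'. A' f'}. \<gamma> f = \<gamma>' f' \<and> T s f = T' s' f'"
    using A[of f f'] * unfolding matches_def by auto
qed

text \<open>Induction with \<open>C\<close> and \<open>C'\<close> arbitrary, because an announcement
  replaces both by their updates. Label invariance makes the transfer lemmas applicable at each
  modality; for \<open>Dyn\<close>, \<open>BoxI_transfer\<close> shows that columns with equal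
  labels pass the announcement together.\<close>

lemma gholds_filtration:
  assumes "\<forall>p\<in>atoms \<phi>. agree p"
    and "label_inv \<rho> R (row_sets \<phi> V T R C)" and "label_inv \<gamma> C (col_sets \<phi> V T R C)"
    and "realizes C C'"
    and "s \<in> R" "s' \<in> R'" "f \<in> C" "f' \<in> C'" "matches s f s' f'"
  shows "gholds \<phi> V T R C s f = gholds \<phi> V' T' R' C' s' f'"
  using assms
proof (induction \<phi> arbitrary: C C' s f s' f')
  case (BoxI \<phi>)
  have "(\<forall>s\<in>R. gholds \<phi> V T R C s f) \<longleftrightarrow> (\<forall>s'\<in>R'. gholds \<phi> V' T' R' C' s' f')"
  proof (rule BoxI_transfer[OF BoxI.prems(4)])
    show "gholds \<phi> V T R C s f = gholds \<phi> V' T' R' C' s' f'"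
      if "s \<in> R" "s' \<in> R'" "f \<in> C" "f' \<in> C'" "matches s f s' f'" for s s' f f'
      by (rule BoxI.IH) (use BoxI.prems that in simp_all)
    show "\<forall>s\<in>R. gholds \<phi> V T R C s g"
      if "f \<in> C" "g \<in> C" "\<gamma> f = \<gamma> g" "\<forall>s\<in>R. gholds \<phi> V T R C s f" for f g
      using BoxI.prems(3) that unfolding col_sets.simps label_inv_simps by blast
  qed (use BoxI.prems in \<open>simp_all add: matches_def\<close>)
  then show ?case by simp
next
  case (BoxF \<phi>)
  have "(\<forall>f\<in>C. gholds \<phi> V T R C s f) \<longleftrightarrow> (\<forall>f'\<in>C'. gholds \<phi> V' T' R' C' s' f')"
  proof (rule BoxF_transfer[OF BoxF.prems(4)])
    show "gholds \<phi> V T R C s f = gholds \<phi> V' T' R' C' s' f'"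
      if "s \<in> R" "s' \<in> R'" "f \<in> C" "f' \<in> C'" "matches s f s' f'" for s s' f f'
      by (rule BoxF.IH) (use BoxF.prems that in simp_all)
    show "\<forall>f\<in>C. gholds \<phi> V T R C t f"
      if "s \<in> R" "t \<in> R" "\<rho> s = \<rho> t" "\<forall>f\<in>C. gholds \<phi> V T R C s f" for s t
      using BoxF.prems(2) that unfolding row_sets.simps label_inv_simps by blast
  qed (use BoxF.prems in \<open>simp_all add: matches_def\<close>)
  then show ?case by simp
next
  case (Dyn \<phi> \<psi>)
  let ?A = "\<lambda>f. \<forall>s\<in>R. gholds \<phi> V T R C s f"
  let ?A' = "\<lambda>f. \<forall>s\<in>R'. gholds \<phi> V' T' R' C' s f"
  have IH: "gholds \<phi> V T R C s f = gholds \<phi> V' T' R' C' s' f'"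
    if "s \<in> R" "s' \<in> R'" "f \<in> C" "f' \<in> C'" "matches s f s' f'" for s s' f f'
    by (rule Dyn.IH(1)) (use Dyn.prems that in simp_all)
  have inv: "?A g" if "f \<in> C" "g \<in> C" "\<gamma> f = \<gamma> g" "?A f" for f g
    using Dyn.prems(3) that unfolding col_sets.simps label_inv_simps by blast
  have A: "?A f \<longleftrightarrow> ?A' f'" if "f \<in> C" "f' \<in> C'" "\<gamma> f = \<gamma>' f'" for f f'
    using BoxI_transfer[OF Dyn.prems(4) inv IH that] .
  have ff': "?A f \<longleftrightarrow> ?A' f'" using A Dyn.prems(7-9) by (simp add: matches_def)
  have "gholds \<psi> V T R {f\<in>C. ?A f} s f = gholds \<psi> V' T' R' {f'\<in>C'. ?A' f'} s' f'" if "?A f"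
  proof (rule Dyn.IH(2))
    show "realizes {f\<in>C. ?A f} {f'\<in>C'. ?A' f'}"
      by (rule realizes_update[OF Dyn.prems(4) inv A])
    show "label_inv \<gamma> {f\<in>C. ?A f} (col_sets \<psi> V T R {f\<in>C. ?A f})"
      by (rule label_inv_subset[of _ C]) (use Dyn.prems(3) in auto)
    show "f \<in> {f\<in>C. ?A f}" "f' \<in> {f'\<in>C'. ?A' f'}"
      using that ff' Dyn.prems(7,8) by auto
  qed (use Dyn.prems in simp_all)
  with ff' show ?case by simp
next
  case (Neg \<phi>)
  have "gholds \<phi> V T R C s f = gholds \<phi> V' T' R' C' s' f'"
    by (rule Neg.IH) (use Neg.prems in simp_all)
  then show ?case by simp
next
  case (Conj \<phi> \<psi>)
  have "gholds \<phi> V T R C s f = gholds \<phi> V' T' R' C' s' f'"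
    by (rule Conj.IH) (use Conj.prems in simp_all)
  moreover have "gholds \<psi> V T R C s f = gholds \<psi> V' T' R' C' s' f'"
    by (rule Conj.IH) (use Conj.prems in simp_all)
  ultimately show ?case by simp
qed (auto simp: agree_def matches_def)

end

section \<open>Bounded numerical models\<close>

lemma set_decode_mod: "x \<in> set_decode (a mod 2 ^ m) \<longleftrightarrow> x < m \<and> x \<in> set_decode a"
  using bit_take_bit_iff[of m a x] unfolding set_decode_def mem_Collect_eq
  by (simp add: bit_iff_odd take_bit_eq_mod)

text \<open>A set digit \<open>x\<close> contributes \<open>2 ^ x\<close>, which exceeds
  \<open>x\<close>. Quantifiers over decoded sets can thus be bounded by the code.\<close>

lemma set_decode_less: "x \<in> set_decode a \<Longrightarrow> x < a"
proof -
  assume "x \<in> set_decode a"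
  then have "set_decode (2 ^ x) \<subseteq> set_decode a"
    using set_encode_inverse[of "{x}"] by (simp add: set_encode_def)
  then show "x < a" using subset_decode_imp_le less_exp order_less_le_trans by blast
qed

lemma set_encode_less: "A \<subseteq> {..<m} \<Longrightarrow> set_encode A < 2 ^ m"
proof -
  assume A: "A \<subseteq> {..<m}"
  then have fin: "finite A" using finite_subset by blast
  have "set_decode (set_encode A mod 2 ^ m) = set_decode (set_encode A)"
    using A fin by (auto simp: set_decode_mod)
  then have "set_encode A mod 2 ^ m = set_encode A" by (metis set_decode_inverse)
  then show ?thesis by (metis mod_less_divisor zero_less_power zero_less_numeral)
qed

text \<open>The low digits will hold outputs and the quotient \<open>G\<close> a column label. The
  induction makes \<open>d N\<close> the lowest digit of the larger quotient
  \<open>G * K + d N\<close>.\<close>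

lemma digits_exist:
  assumes "\<And>r. r < N \<Longrightarrow> d r < (K::nat)"
  shows "\<exists>f. f div K ^ N = G \<and> (\<forall>r<N. f div K ^ r mod K = d r)"
  using assms
proof (induction N arbitrary: G)
  case (Suc N)
  have d: "d N < K" using Suc.prems by simp
  obtain f where f: "f div K ^ N = G * K + d N" "\<forall>r<N. f div K ^ r mod K = d r"
    using Suc.IH[of "G * K + d N"] Suc.prems by auto
  have "f div K ^ Suc N = f div K ^ N div K" by (simp only: power_Suc2 div_mult2_eq)
  then show ?case using f d by (intro exI[of _ f]) (auto simp: less_Suc_eq)
qed simp

lemma add_le_prod_encode: "a + b \<le> prod_encode (a, b)"
proof -
  have "k \<le> triangle k" for k by (induction k) simp_all
  then show ?thesis unfolding prod_encode_def split using trans_le_add1 by blast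
qed

lemma to_nat_on_less_card: "finite A \<Longrightarrow> x \<in> A \<Longrightarrow> to_nat_on A x < card A"
  using to_nat_on_finite[of A] bij_betwE by blast

text \<open>A code is at least its tag plus the codes of the immediate subformulas. The list grows
  by one only at \<open>BoxF\<close>, where the tag pays for the new entry; \<open>BoxI\<close> and
  \<open>Dyn\<close> play this part for \<open>col_sets\<close>.\<close>

lemma length_row_sets: "length (row_sets \<phi> V T R C) \<le> code Atm Val \<phi>"
proof (induction \<phi> arbitrary: C)
  case (Neg \<phi>)
  then show ?case using add_le_prod_encode[of 2 "code Atm Val \<phi>"] by (simp add: le_trans[OF Neg.IH])
next
  case (Conj \<phi> \<psi>)
  show ?case
    using add_le_prod_encode[of 3 "prod_encode (code Atm Val \<phi>, code Atm Val \<psi>)"]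
      add_le_prod_encode[of "code Atm Val \<phi>" "code Atm Val \<psi>"] Conj.IH(1)[of C] Conj.IH(2)[of C]
    by simp
next
  case (BoxI \<phi>)
  then show ?case using add_le_prod_encode[of 4 "code Atm Val \<phi>"] by (simp add: le_trans[OF BoxI.IH])
next
  case (BoxF \<phi>)
  show ?case using add_le_prod_encode[of 5 "code Atm Val \<phi>"] BoxF.IH[of C] by simp
next
  case (Dyn \<phi> \<psi>)
  let ?D = "{f\<in>C. \<forall>s\<in>R. gholds \<phi> V T R C s f}"
  show ?case
    using add_le_prod_encode[of 6 "prod_encode (code Atm Val \<phi>, code Atm Val \<psi>)"]
      add_le_prod_encode[of "code Atm Val \<phi>" "code Atm Val \<psi>"] Dyn.IH(1)[of C] Dyn.IH(2)[of ?D]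
    by simp
qed simp_all

lemma length_col_sets: "length (col_sets \<phi> V T R C) \<le> code Atm Val \<phi>"
proof (induction \<phi> arbitrary: C)
  case (Neg \<phi>)
  then show ?case using add_le_prod_encode[of 2 "code Atm Val \<phi>"] by (simp add: le_trans[OF Neg.IH])
next
  case (Conj \<phi> \<psi>)
  show ?case
    using add_le_prod_encode[of 3 "prod_encode (code Atm Val \<phi>, code Atm Val \<psi>)"]
      add_le_prod_encode[of "code Atm Val \<phi>" "code Atm Val \<psi>"] Conj.IH(1)[of C] Conj.IH(2)[of C]
    by simp
next
  case (BoxI \<phi>)
  show ?case using add_le_prod_encode[of 4 "code Atm Val \<phi>"] BoxI.IH[of C] by simp
next
  case (BoxF \<phi>)
  then show ?case using add_le_prod_encode[of 5 "code Atm Val \<phi>"] by (simp add: le_trans[OF BoxF.IH])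
next
  case (Dyn \<phi> \<psi>)
  let ?D = "{f\<in>C. \<forall>s\<in>R. gholds \<phi> V T R C s f}"
  show ?case
    using add_le_prod_encode[of 6 "prod_encode (code Atm Val \<phi>, code Atm Val \<psi>)"]
      add_le_prod_encode[of "code Atm Val \<phi>" "code Atm Val \<psi>"] Dyn.IH(1)[of C] Dyn.IH(2)[of ?D]
    by simp
qed simp_all

lemma to_nat_on_atoms_le: "p \<in> atoms \<phi> \<Longrightarrow> to_nat_on Atm p \<le> code Atm Val \<phi>"
proof (induction \<phi>)
  case (Atom q)
  then show ?case using le_prod_encode_2 by simp
next
  case (Conj \<phi> \<psi>)
  then show ?case
    using le_prod_encode_2[of "prod_encode (code Atm Val \<phi>, code Atm Val \<psi>)" 3]
      add_le_prod_encode[of "code Atm Val \<phi>" "code Atm Val \<psi>"] by auto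
next
  case (Dyn \<phi> \<psi>)
  then show ?case
    using le_prod_encode_2[of "prod_encode (code Atm Val \<phi>, code Atm Val \<psi>)" 6]
      add_le_prod_encode[of "code Atm Val \<phi>" "code Atm Val \<psi>"] by auto
qed (auto intro: le_trans[OF _ le_prod_encode_2])

text \<open>A numerical row is the set of atoms whose indices are the binary digits set in \<open>s\<close>; the output
  of a numerical column \<open>f\<close> in row \<open>s\<close> is given by the digit \<open>s\<close> of \<open>f\<close> in base \<open>card Val\<close>.\<close>

definition row_val :: "'a set \<Rightarrow> nat \<Rightarrow> 'a \<Rightarrow> bool" where
  "row_val Atm s p \<longleftrightarrow> to_nat_on Atm p \<in> set_decode s"

definition digit_val :: "'v set \<Rightarrow> nat \<Rightarrow> nat \<Rightarrow> 'v" where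
  "digit_val Val s f = from_nat_into Val (f div card Val ^ s mod card Val)"

abbreviation nholds :: "'a set \<Rightarrow> 'v set \<Rightarrow> ('a, 'v) fm \<Rightarrow> nat set \<Rightarrow> nat set \<Rightarrow> nat \<Rightarrow> nat \<Rightarrow> bool" where
  "nholds Atm Val \<phi> R C s f \<equiv> gholds \<phi> (row_val Atm) (digit_val Val) R C s f"

section \<open>Passing between numerical and multi-classifier models\<close>

lemma digit_val_in: "Val \<noteq> {} \<Longrightarrow> digit_val Val s f \<in> Val"
  by (simp add: digit_val_def from_nat_into)

text \<open>All positions below \<open>M\<close> are indices of atoms, so distinct numerical rows
  are distinct subsets of \<open>Atm\<close>. Columns may collapse to one classifier, which
  \<open>gholds_image\<close> permits.\<close>

lemma nholds_imp_satisfiable: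
  assumes cA: "countable Atm" and Val: "Val \<noteq> {}" and \<phi>: "\<phi> \<in> L_dyn Atm Val"
    and M: "{..<M} \<subseteq> to_nat_on Atm ` Atm" and R: "R \<subseteq> {..<2 ^ M}"
    and s: "s \<in> R" and f: "f \<in> C" and h: "nholds Atm Val \<phi> R C s f"
  shows "satisfiable Atm Val \<phi>"
proof -
  define g where "g s = {p \<in> Atm. to_nat_on Atm p \<in> set_decode s}" for s
  have inj: "inj_on g R"
  proof
    fix s t assume st: "s \<in> R" "t \<in> R" "g s = g t"
    have *: "x \<in> set_decode s \<longleftrightarrow> x < M \<and> x \<in> set_decode s" if "s \<in> R" for x s
      using set_decode_mod[of x s M] that R by (auto simp: subset_iff)
    have "x \<in> set_decode s \<longleftrightarrow> x \<in> set_decode t" if "x < M" for x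
    proof -
      obtain p where "p \<in> Atm" "x = to_nat_on Atm p" using M \<open>x < M\<close> by blast
      then show ?thesis using \<open>g s = g t\<close> unfolding g_def by blast
    qed
    then have "set_decode s = set_decode t" using * st by blast
    then show "s = t" by (metis set_decode_inverse)
  qed
  define c where "c f = restrict (\<lambda>t. digit_val Val (inv_into R g t) f) (g ` R)" for f
  have "gholds \<phi> (\<lambda>s p. p \<in> s) (\<lambda>s f. f s) (g ` R) (c ` C) (g s) (c f)"
  proof (subst gholds_image)
    show "(p \<in> g s) = row_val Atm s p" if "p \<in> atoms \<phi>" for p s
      using \<phi> that unfolding g_def row_val_def L_dyn_def by auto
    show "c f (g s) = digit_val Val s f" if "s \<in> R" for s f
      using inj that unfolding c_def by simp
  qed (use s f h in auto)
  moreover have "(g ` R, c ` C) \<in> MCM Atm Val"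
    unfolding MCM_def using digit_val_in[OF Val] by (auto simp: g_def c_def)
  ultimately show ?thesis unfolding satisfiable_def using s f
    by (intro bexI[of _ "(g ` R, c ` C)"]) (auto simp: holds_eq_gholds)
qed

text \<open>A model has at most \<open>2 ^ card Atm\<close> rows, and a classifier is written out
  directly as its table of output digits, with quotient 0 above them.\<close>

lemma satisfiable_imp_nholds_finite:
  assumes fA: "finite Atm" and fV: "finite Val" and \<phi>: "\<phi> \<in> L_dyn Atm Val"
    and sat: "satisfiable Atm Val \<phi>"
  shows "\<exists>R\<subseteq>{..<2 ^ card Atm}. \<exists>C\<subseteq>{..<card Val ^ 2 ^ card Atm}. \<exists>s\<in>R. \<exists>f\<in>C. nholds Atm Val \<phi> R C s f"
proof -
  let ?K = "card Val" and ?N = "2 ^ card Atm"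
  obtain S \<Phi> s f where S: "S \<subseteq> Pow Atm" "\<Phi> \<subseteq> (S \<rightarrow>\<^sub>E Val)" "s \<in> S" "f \<in> \<Phi>"
    "gholds \<phi> (\<lambda>s p. p \<in> s) (\<lambda>s f. f s) S \<Phi> s f"
    using sat unfolding satisfiable_def MCM_def by (auto simp: holds_eq_gholds)
  then have K: "?K > 0" using fV by (auto simp: card_gt_0_iff)
  define g where "g s = set_encode (to_nat_on Atm ` s)" for s
  have dec: "set_decode (g s) = to_nat_on Atm ` s" if "s \<in> S" for s
    unfolding g_def using S(1) that fA by (intro set_encode_inverse) (auto intro: finite_subset)
  have iff: "to_nat_on Atm p \<in> to_nat_on Atm ` s \<longleftrightarrow> p \<in> s" if "p \<in> Atm" "s \<in> S" for p s
    using S(1) that fA inj_on_to_nat_on[of Atm]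
    by (intro inj_on_image_mem_iff) (auto simp: countable_finite)
  have inj: "inj_on g S"
  proof
    fix s t assume st: "s \<in> S" "t \<in> S" "g s = g t"
    then have "to_nat_on Atm ` s = to_nat_on Atm ` t" using dec by metis
    then show "s = t" using iff st S(1) by blast
  qed
  have less: "g s < ?N" if "s \<in> S" for s
  proof -
    have "to_nat_on Atm ` s \<subseteq> {..<card Atm}"
      using to_nat_on_less_card[OF fA] S(1) that by auto
    then show ?thesis unfolding g_def by (rule set_encode_less)
  qed
  \<comment> \<open>\<open>mod ?K\<close> yields a legal digit at positions that name no row and for
    functions outside \<open>\<Phi>\<close>; at actual rows and classifiers it changes nothing, as
    output indices are below \<open>?K\<close>.\<close>
  have "\<exists>c. c div ?K ^ ?N = 0 \<and>
      (\<forall>r<?N. c div ?K ^ r mod ?K = to_nat_on Val (f (inv_into S g r)) mod ?K)" for f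
    by (rule digits_exist) (use K in simp)
  then obtain c where c: "\<And>f. c f div ?K ^ ?N = 0"
    "\<And>f r. r < ?N \<Longrightarrow> c f div ?K ^ r mod ?K = to_nat_on Val (f (inv_into S g r)) mod ?K"
    by metis
  have "nholds Atm Val \<phi> (g ` S) (c ` \<Phi>) (g s) (c f)"
  proof (subst gholds_image)
    show "row_val Atm (g s) p = (p \<in> s)" if "s \<in> S" "p \<in> atoms \<phi>" for s p
      using that iff[of p s] dec[of s] \<phi> unfolding row_val_def L_dyn_def by auto
    show "digit_val Val (g s) (c f) = f s" if "s \<in> S" "f \<in> \<Phi>" for s f
    proof -
      have "f s \<in> Val" using that S(2) by auto
      then show ?thesis unfolding digit_val_def
        using c(2)[OF less[OF \<open>s \<in> S\<close>]] inj that to_nat_on_less_card[OF fV] fV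
        by (simp add: countable_finite)
    qed
  qed (use S in auto)
  moreover have "c f < ?K ^ ?N" for f using c(1)[of f] K by (simp add: div_eq_0_iff)
  ultimately show ?thesis using less S
    by (intro exI[of _ "g ` S"] exI[of _ "c ` \<Phi>"] conjI bexI[of _ "g s"] bexI[of _ "c f"]) auto
qed

text \<open>A row number has \<open>n\<close> bits for atoms, \<open>n\<close> for the truth of
  \<open>BoxF\<close> formulas and \<open>card Val\<close> for the copy number. In a column number,
  the quotient by \<open>card Val ^ 2 ^ M\<close> is the label, which is below \<open>2 ^ n\<close>.
  Taking \<open>n\<close> one above the code accommodates every atom index in \<open>\<phi>\<close>
  and the lengths of both lists.\<close>

lemma satisfiable_imp_nholds_infinite:
  assumes cA: "countable Atm" and iA: "infinite Atm" and fV: "finite Val" and \<phi>: "\<phi> \<in> L_dyn Atm Val"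
    and sat: "satisfiable Atm Val \<phi>"
    and n: "n = Suc (code Atm Val \<phi>)" and M: "M = 2 * n + card Val"
  shows "\<exists>R\<subseteq>{..<2 ^ M}. \<exists>C\<subseteq>{..<card Val ^ 2 ^ M * 2 ^ n}. \<exists>s\<in>R. \<exists>f\<in>C. nholds Atm Val \<phi> R C s f"
proof -
  let ?K = "card Val" and ?N = "2 ^ M :: nat" and ?B = "2 ^ (2 * n) :: nat"
  obtain S \<Phi> s0 f0 where S: "S \<subseteq> Pow Atm" "\<Phi> \<subseteq> (S \<rightarrow>\<^sub>E Val)" "s0 \<in> S" "f0 \<in> \<Phi>"
    "gholds \<phi> (\<lambda>s p. p \<in> s) (\<lambda>s f. f s) S \<Phi> s0 f0"
    using sat unfolding satisfiable_def MCM_def by (auto simp: holds_eq_gholds)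
  then have K: "?K > 0" using fV by (auto simp: card_gt_0_iff)
  have cV: "countable Val" using fV by (rule countable_finite)
  define rs where "rs = row_sets \<phi> (\<lambda>s p. p \<in> s) (\<lambda>s f. f s) S \<Phi>"
  define cs where "cs = col_sets \<phi> (\<lambda>s p. p \<in> s) (\<lambda>s f. f s) S \<Phi>"
  have len: "length rs < n" "length cs < n"
    unfolding rs_def cs_def n less_Suc_eq_le by (rule length_row_sets length_col_sets)+
  define rset where "rset s = {i. i < n \<and> i \<in> to_nat_on Atm ` s} \<union> {n + i |i. i < length rs \<and> s \<in> rs ! i}" for s
  define \<rho> where "\<rho> s = set_encode (rset s)" for s
  define \<gamma> where "\<gamma> f = set_encode {i. i < length cs \<and> f \<in> cs ! i}" for f
  have rset: "rset s \<subseteq> {..<2 * n}" for s using len unfolding rset_def by auto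
  then have "finite (rset s)" for s using finite_subset by blast
  then have \<rho>_dec: "set_decode (\<rho> s) = rset s" for s unfolding \<rho>_def by simp
  have \<rho>_less: "\<rho> s < ?B" for s unfolding \<rho>_def using rset by (rule set_encode_less)
  have \<gamma>_less: "\<gamma> f < 2 ^ n" and \<gamma>_dec: "set_decode (\<gamma> f) = {i. i < length cs \<and> f \<in> cs ! i}" for f
    using len unfolding \<gamma>_def by (auto intro!: set_encode_less)
  \<comment> \<open>\<open>W L G\<close> holds the outputs that occur between the labels
    \<open>L\<close> and \<open>G\<close>. If it is nonempty, \<open>e L G\<close> maps the indices
    of \<open>Val\<close> onto it, sending those of other outputs to a fixed member.\<close>
  define W where "W L G = {f s |s f. s \<in> S \<and> f \<in> \<Phi> \<and> \<rho> s = L \<and> \<gamma> f = G}" for L G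
  define e where "e L G i = (if from_nat_into Val i \<in> W L G then from_nat_into Val i else (SOME v. v \<in> W L G))" for L G i
  have W_Val: "W L G \<subseteq> Val" for L G using S(2) unfolding W_def by auto
  have e_in: "e L G i \<in> W L G" if "v \<in> W L G" for v L G i
    using that unfolding e_def by (auto intro: someI)
  have e_surj: "\<exists>i<?K. e L G i = v" if "v \<in> W L G" for v L G
    using that W_Val[of L G] to_nat_on_less_card[OF fV] cV unfolding e_def
    by (intro exI[of _ "to_nat_on Val v"]) auto
  \<comment> \<open>In row \<open>r\<close>, the remainder by \<open>?B\<close> is the label and the
    quotient the copy number; column copy \<open>j\<close> shifts the enumeration cyclically by
    \<open>j\<close>. The outer \<open>mod ?K\<close> makes the digit legal where \<open>W\<close>
    is empty.\<close>
  have "\<exists>c. c div ?K ^ ?N = G \<and> (\<forall>r<?N. c div ?K ^ r mod ?K =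
      to_nat_on Val (e (r mod ?B) G ((r div ?B + j) mod ?K)) mod ?K)" for G j
    by (rule digits_exist) (use K in simp)
  then obtain F where F: "\<And>G j. F G j div ?K ^ ?N = G"
    "\<And>G j r. r < ?N \<Longrightarrow> F G j div ?K ^ r mod ?K =
      to_nat_on Val (e (r mod ?B) G ((r div ?B + j) mod ?K)) mod ?K"
    by metis
  define row where "row s k = \<rho> s + ?B * k" for s k
  have row_mod: "row s k mod ?B = \<rho> s" and row_div: "row s k div ?B = k" for s k
    using \<rho>_less[of s] unfolding row_def by simp_all
  have row_less: "row s k < ?N" if "k < ?K" for s k
  proof -
    have "row s k < ?B * Suc k" using \<rho>_less[of s] unfolding row_def by simp
    also have "\<dots> \<le> ?B * 2 ^ ?K"
      using that less_exp[of ?K] by (intro mult_le_mono2) linarith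
    finally show ?thesis unfolding M by (simp add: power_add)
  qed
  define R where "R = {row s k |s k. s \<in> S \<and> k < ?K}"
  define C where "C = {F (\<gamma> f) j |f j. f \<in> \<Phi> \<and> j < ?K}"
  have val: "digit_val Val (row s k) (F (\<gamma> f) j) = e (\<rho> s) (\<gamma> f) ((k + j) mod ?K)"
    if "s \<in> S" "f \<in> \<Phi>" "k < ?K" for s f k j
  proof -
    have "f s \<in> W (\<rho> s) (\<gamma> f)" using that unfolding W_def by blast
    then have "e (\<rho> s) (\<gamma> f) i \<in> Val" for i using e_in W_Val by blast
    then show ?thesis unfolding digit_val_def
      using F(2)[OF row_less[OF \<open>k < ?K\<close>]] to_nat_on_less_card[OF fV] cV
      by (simp add: row_mod row_div)
  qed
  \<comment> \<open>With one copy number fixed, the other can produce any index. This gives both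
    forth conditions of \<open>realizes\<close>.\<close>
  have shift: "\<exists>k<?K. (k + j) mod ?K = i" if "i < ?K" "j < ?K" for i j
    using that K by (intro exI[of _ "(i + ?K - j) mod ?K"]) (simp add: mod_add_left_eq)
  interpret filtration "\<lambda>s p. p \<in> s" "\<lambda>s f. f s" S \<rho> \<gamma> "row_val Atm" "digit_val Val" R
    "\<lambda>r. r mod ?B" "\<lambda>c. c div ?K ^ ?N" .
  have agr: "\<forall>p\<in>atoms \<phi>. agree p"
    unfolding agree_def row_val_def
  proof (intro ballI impI)
    fix p s r assume p: "p \<in> atoms \<phi>" and s: "s \<in> S" and eq: "\<rho> s = r mod ?B"
    have pA: "p \<in> Atm" "to_nat_on Atm p < n"
      using p \<phi> to_nat_on_atoms_le[OF p, of Atm Val] unfolding L_dyn_def n by auto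
    \<comment> \<open>The index is below \<open>n\<close>, so it lies among the label bits and in
      the part of \<open>rset\<close> that records atoms.\<close>
    have "to_nat_on Atm p \<in> set_decode r \<longleftrightarrow> to_nat_on Atm p \<in> set_decode (\<rho> s)"
      unfolding eq set_decode_mod using pA by simp
    also have "\<dots> \<longleftrightarrow> to_nat_on Atm p \<in> to_nat_on Atm ` s"
      unfolding \<rho>_dec rset_def using pA by auto
    also have "\<dots> \<longleftrightarrow> p \<in> s"
      using S(1) s pA inj_on_to_nat_on[OF cA] by (intro inj_on_image_mem_iff) auto
    finally show "(to_nat_on Atm p \<in> set_decode r) = (p \<in> s)" .
  qed
  have inv_rows: "label_inv \<rho> S rs"
    unfolding label_inv_def
  proof (intro ballI impI)
    fix X s t assume "X \<in> set rs" "\<rho> s = \<rho> t" "s \<in> X"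
    then obtain i where i: "i < length rs" "X = rs ! i" by (auto simp: in_set_conv_nth)
    then have "n + i \<in> rset s" using \<open>s \<in> X\<close> unfolding rset_def by blast
    then have "n + i \<in> rset t" using \<open>\<rho> s = \<rho> t\<close> \<rho>_dec by metis
    then show "t \<in> X" using i unfolding rset_def by simp
  qed
  have inv_cols: "label_inv \<gamma> \<Phi> cs"
    unfolding label_inv_def
  proof (intro ballI impI)
    fix X f g assume "X \<in> set cs" "\<gamma> f = \<gamma> g" "f \<in> X"
    then obtain i where i: "i < length cs" "X = cs ! i" by (auto simp: in_set_conv_nth)
    then have "i \<in> set_decode (\<gamma> f)" using \<open>f \<in> X\<close> unfolding \<gamma>_dec by blast
    then show "g \<in> X" using i unfolding \<open>\<gamma> f = \<gamma> g\<close> \<gamma>_dec by simp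
  qed
  have real: "realizes \<Phi> C"
    unfolding realizes_def
  proof (intro conjI ballI impI)
    fix r c assume "r \<in> R" "c \<in> C"
    then obtain s k f j where *: "s \<in> S" "k < ?K" "r = row s k" "f \<in> \<Phi>" "c = F (\<gamma> f) j"
      unfolding R_def C_def by blast
    then have "f s \<in> W (\<rho> s) (\<gamma> f)" unfolding W_def by blast
    \<comment> \<open>Membership in \<open>W\<close> yields an old cell with these labels and this
      output, possibly other than the pair \<open>s\<close>, \<open>f\<close> that gave the
      labels.\<close>
    then have "digit_val Val r c \<in> W (\<rho> s) (\<gamma> f)" using val * e_in by simp
    then show "\<exists>s\<in>S. \<exists>f\<in>\<Phi>. \<rho> s = r mod ?B \<and> \<gamma> f = c div ?K ^ ?N \<and> f s = digit_val Val r c"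
      unfolding W_def * row_mod F(1) by force
  next
    fix s f c assume s: "s \<in> S" and f: "f \<in> \<Phi>" and c: "c \<in> C" "\<gamma> f = c div ?K ^ ?N"
    then obtain j where j: "c = F (\<gamma> f) j" "j < ?K" unfolding C_def using F(1) by auto
    have "f s \<in> W (\<rho> s) (\<gamma> f)" using s f unfolding W_def by blast
    then obtain i where i: "i < ?K" "e (\<rho> s) (\<gamma> f) i = f s" using e_surj by blast
    then obtain k where k: "k < ?K" "(k + j) mod ?K = i" using shift j by blast
    then have "row s k \<in> R" unfolding R_def using s by blast
    then show "\<exists>r\<in>R. \<rho> s = r mod ?B \<and> f s = digit_val Val r c"
      using i k j s f by (intro bexI[of _ "row s k"]) (simp_all add: val row_mod)
  next
    fix s f r assume s: "s \<in> S" and f: "f \<in> \<Phi>" and r: "r \<in> R" "\<rho> s = r mod ?B"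
    then obtain t k where tk: "r = row t k" "k < ?K" "t \<in> S" "\<rho> s = \<rho> t"
      unfolding R_def using row_mod by auto
    have "f s \<in> W (\<rho> s) (\<gamma> f)" using s f unfolding W_def by blast
    then obtain i where i: "i < ?K" "e (\<rho> s) (\<gamma> f) i = f s" using e_surj by blast
    then obtain j where j: "j < ?K" "(j + k) mod ?K = i" using shift tk by blast
    then have "F (\<gamma> f) j \<in> C" unfolding C_def using f by blast
    then show "\<exists>c\<in>C. \<gamma> f = c div ?K ^ ?N \<and> f s = digit_val Val r c"
      using i j tk f by (intro bexI[of _ "F (\<gamma> f) j"]) (simp_all add: val F(1) add.commute)
  qed
  have c0: "F (\<gamma> f0) 0 \<in> C" unfolding C_def using S K by blast
  obtain r where r: "r \<in> R" "matches s0 f0 r (F (\<gamma> f0) 0)"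
    using realizes_row[OF real S(3,4) c0] F(1) by metis
  have "nholds Atm Val \<phi> R C r (F (\<gamma> f0) 0)"
    using gholds_filtration[OF agr _ _ real S(3) r(1) S(4) c0 r(2)] inv_rows inv_cols S(5)
    unfolding rs_def cs_def by blast
  moreover have "R \<subseteq> {..<?N}" unfolding R_def using row_less by auto
  moreover have "C \<subseteq> {..<?K ^ ?N * 2 ^ n}"
  proof -
    have "F (\<gamma> f) j < ?K ^ ?N * 2 ^ n" for f j
      using F(1)[of "\<gamma> f" j] \<gamma>_less[of f] K
      by (metis div_less_iff_less_mult mult.commute zero_less_power)
    then show ?thesis unfolding C_def by auto
  qed
  ultimately show ?thesis using r(1) c0 by blast
qed

section \<open>The decision procedure\<close>

text \<open>For finite \<open>Atm\<close> rows are confined to \<open>card Atm\<close> bits, since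
  only these name atoms; for infinite \<open>Atm\<close> every bit names one. The bound on
  \<open>u\<close> covers both cases.\<close>

lemma satisfiable_iff_bounded:
  fixes \<phi> :: "('a, 'v) fm"
  assumes cA: "countable Atm" and fV: "finite Val" and Val: "Val \<noteq> {}" and \<phi>: "\<phi> \<in> L_dyn Atm Val"
    and M: "M = (if finite Atm then card Atm else 2 * Suc (code Atm Val \<phi>) + card Val)"
  shows "satisfiable Atm Val \<phi> \<longleftrightarrow>
    (\<exists>\<sigma><2 ^ 2 ^ M. \<exists>u<2 ^ (card Val ^ 2 ^ M * 2 ^ Suc (code Atm Val \<phi>)). \<exists>s\<in>set_decode \<sigma>. \<exists>f\<in>set_decode u.
       nholds Atm Val \<phi> (set_decode \<sigma>) (set_decode u) s f)" (is "_ \<longleftrightarrow> ?bounded")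
proof
  assume ?bounded
  then obtain \<sigma> u s f where *: "\<sigma> < 2 ^ 2 ^ M" "s \<in> set_decode \<sigma>" "f \<in> set_decode u"
    "nholds Atm Val \<phi> (set_decode \<sigma>) (set_decode u) s f" by blast
  have "{..<M} \<subseteq> to_nat_on Atm ` Atm"
    using image_to_nat_on[OF cA] to_nat_on_finite[of Atm] unfolding M bij_betw_def by auto
  moreover have "set_decode \<sigma> \<subseteq> {..<2 ^ M}"
    using set_decode_mod[of _ \<sigma> "2 ^ M"] *(1) by auto
  ultimately show "satisfiable Atm Val \<phi>"
    using nholds_imp_satisfiable[OF cA Val \<phi>] *(2-) by blast
next
  assume sat: "satisfiable Atm Val \<phi>"
  let ?N = "card Val ^ 2 ^ M * 2 ^ Suc (code Atm Val \<phi>)"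
  have "\<exists>R\<subseteq>{..<2 ^ M}. \<exists>C\<subseteq>{..<?N}. \<exists>s\<in>R. \<exists>f\<in>C. nholds Atm Val \<phi> R C s f"
  proof (cases "finite Atm")
    case True
    obtain R C where "R \<subseteq> {..<2 ^ M}" "C \<subseteq> {..<card Val ^ 2 ^ M}" "\<exists>s\<in>R. \<exists>f\<in>C. nholds Atm Val \<phi> R C s f"
      using satisfiable_imp_nholds_finite[OF True fV \<phi> sat] True unfolding M by auto
    moreover have "card Val ^ 2 ^ M \<le> ?N" by simp
    ultimately show ?thesis by (meson lessThan_subset_iff subset_trans)
  next
    case False
    then show ?thesis using satisfiable_imp_nholds_infinite[OF cA False fV \<phi> sat refl] unfolding M by simp
  qed
  then obtain R C s f where RC: "R \<subseteq> {..<2 ^ M}" "C \<subseteq> {..<?N}" "s \<in> R" "f \<in> C"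
    "nholds Atm Val \<phi> R C s f" by blast
  then have "finite R" "finite C" using finite_subset by blast+
  then show ?bounded using RC set_encode_less
    by (intro exI[of _ "set_encode R"] exI[of _ "set_encode C"] conjI bexI[of _ s] bexI[of _ f]) auto
qed

text \<open>An initial segment of \<open>A\<close>, coded as a number, is found by unbounded search.\<close>

lemma pr_course_of_values:
  assumes A: "\<And>c. c \<in> A \<longleftrightarrow> G c (\<lambda>x. x \<in> A)"
    and cong: "\<And>c P Q. (\<And>x. x < c \<Longrightarrow> P x \<longleftrightarrow> Q x) \<Longrightarrow> G c P \<longleftrightarrow> G c Q"
    and G: "\<And>n f h. rc n f \<Longrightarrow> rc n h \<Longrightarrow> pr n (\<lambda>xs. G (f xs) (\<lambda>x. x \<in> set_decode (h xs)))"
    and f: "rc n f"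
  shows "pr n (\<lambda>xs. f xs \<in> A)"
proof -
  define table where "table n w \<longleftrightarrow> (\<forall>c\<le>n. c \<in> set_decode w \<longleftrightarrow> G c (\<lambda>x. x \<in> set_decode w))" for n w
  \<comment> \<open>The genuine segment of \<open>A\<close> is a table, because \<open>cong\<close>
    confines \<open>G c\<close> to arguments below \<open>c\<close>.\<close>
  have ex: "\<exists>w. table n w" for n
  proof -
    have eq: "set_decode (set_encode {c\<in>A. c \<le> n}) = {c\<in>A. c \<le> n}" by simp
    have "c \<in> {c\<in>A. c \<le> n} \<longleftrightarrow> G c (\<lambda>x. x \<in> {c\<in>A. c \<le> n})" if "c \<le> n" for c
      using A[of c] cong[of c "\<lambda>x. x \<in> A" "\<lambda>x. x \<in> {c\<in>A. c \<le> n}"] that by simp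
    then have "table n (set_encode {c\<in>A. c \<le> n})" unfolding table_def eq by blast
    then show ?thesis ..
  qed
  \<comment> \<open>Conversely, every table agrees with \<open>A\<close> up to \<open>n\<close>, so
    it does not matter which one the search returns.\<close>
  have uniq: "c \<in> set_decode w \<longleftrightarrow> c \<in> A" if "table n w" "c \<le> n" for n w c
    using that(2)
  proof (induction c rule: less_induct)
    case (less c)
    then show ?case
      using A[of c] cong[of c "\<lambda>x. x \<in> A" "\<lambda>x. x \<in> set_decode w"] that(1) unfolding table_def by simp
  qed
  have "rc 1 (\<lambda>xs. LEAST w. table (hd xs) w)"
  proof (rule rc_Least)
    show "pr (Suc 1) (\<lambda>zs. table (hd (tl zs)) (hd zs))"
      unfolding table_def by (intro G recursive_intros; simp)
  qed (rule ex)
  then have "pr 1 (\<lambda>xs. hd xs \<in> set_decode (LEAST w. table (hd xs) w))"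
    by (intro recursive_intros) simp_all
  moreover have "x \<in> set_decode (LEAST w. table x w) \<longleftrightarrow> x \<in> A" for x
    using uniq LeastI_ex[OF ex] by blast
  ultimately have "pr 1 (\<lambda>xs. hd xs \<in> A)" by simp
  then show ?thesis using f by (rule pr_subst1)
qed

section \<open>Recognising the codes of formulas\<close>

locale decision =
  fixes Atm :: "'a set" and Val :: "'v set"
  assumes cA: "countable Atm" and fV: "finite Val" and Val: "Val \<noteq> {}"
begin

abbreviation "codes \<equiv> code Atm Val ` L_dyn Atm Val"

definition code_step :: "nat \<Rightarrow> (nat \<Rightarrow> bool) \<Rightarrow> bool" where
  "code_step c P \<longleftrightarrow>
    fst (prod_decode c) = 0 \<and> snd (prod_decode c) \<in> to_nat_on Atm ` Atm \<or>
    fst (prod_decode c) = 1 \<and> snd (prod_decode c) < card Val \<or>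
    (fst (prod_decode c) = 2 \<or> fst (prod_decode c) = 4 \<or> fst (prod_decode c) = 5) \<and> P (snd (prod_decode c)) \<or>
    (fst (prod_decode c) = 3 \<or> fst (prod_decode c) = 6) \<and>
      P (fst (prod_decode (snd (prod_decode c)))) \<and> P (snd (prod_decode (snd (prod_decode c))))"

lemma snd_prod_decode_less: "fst (prod_decode c) > 0 \<Longrightarrow> snd (prod_decode c) < c"
  using add_le_prod_encode[of "fst (prod_decode c)" "snd (prod_decode c)"] by simp

lemma fst_prod_decode_le: "fst (prod_decode c) \<le> c"
  using le_prod_encode_1[of "fst (prod_decode c)" "snd (prod_decode c)"] by simp

lemma snd_prod_decode_le: "snd (prod_decode c) \<le> c"
  using le_prod_encode_2[of "snd (prod_decode c)" "fst (prod_decode c)"] by simp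

text \<open>\<open>P\<close> is consulted only under a positive tag, and then the payload and its
  components are smaller than \<open>c\<close>.\<close>

lemma code_step_cong:
  assumes "\<And>x. x < c \<Longrightarrow> P x \<longleftrightarrow> Q x"
  shows "code_step c P \<longleftrightarrow> code_step c Q"
proof (cases "fst (prod_decode c) > 0")
  case True
  let ?r = "snd (prod_decode c)"
  have "?r < c" using snd_prod_decode_less[OF True] .
  then have "fst (prod_decode ?r) < c" "snd (prod_decode ?r) < c"
    using fst_prod_decode_le[of ?r] snd_prod_decode_le[of ?r] by linarith+
  then show ?thesis unfolding code_step_def using assms \<open>?r < c\<close> by simp
qed (simp add: code_step_def)

lemma to_nat_on_Val: "to_nat_on Val ` Val = {..<card Val}"
  using to_nat_on_finite[OF fV] by (simp add: bij_betw_def)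

lemma codes_eq: "c \<in> codes \<longleftrightarrow> code_step c (\<lambda>x. x \<in> codes)"
proof
  assume "c \<in> codes"
  then obtain \<phi> where "\<phi> \<in> L_dyn Atm Val" "c = code Atm Val \<phi>" by blast
  then show "code_step c (\<lambda>x. x \<in> codes)"
    using to_nat_on_less_card[OF fV] by (cases \<phi>) (auto simp: code_step_def L_dyn_def)
next
  assume *: "code_step c (\<lambda>x. x \<in> codes)"
  obtain t r where c: "c = prod_encode (t, r)" by (metis prod_decode_inverse prod.collapse)
  obtain r1 r2 where r: "r = prod_encode (r1, r2)" by (metis prod_decode_inverse prod.collapse)
  from * consider p where "t = 0" "p \<in> Atm" "r = to_nat_on Atm p"
    | x where "t = 1" "x \<in> Val" "r = to_nat_on Val x"
    | \<phi> where "t \<in> {2, 4, 5}" "\<phi> \<in> L_dyn Atm Val" "r = code Atm Val \<phi>"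
    | \<phi> \<psi> where "t \<in> {3, 6}" "\<phi> \<in> L_dyn Atm Val" "\<psi> \<in> L_dyn Atm Val" "r1 = code Atm Val \<phi>" "r2 = code Atm Val \<psi>"
  proof -
    have "r < card Val \<Longrightarrow> r \<in> to_nat_on Val ` Val" unfolding to_nat_on_Val by simp
    moreover have "t = 0 \<and> r \<in> to_nat_on Atm ` Atm \<or> t = 1 \<and> r < card Val \<or>
        t \<in> {2, 4, 5} \<and> r \<in> codes \<or> t \<in> {3, 6} \<and> r1 \<in> codes \<and> r2 \<in> codes"
      using * unfolding code_step_def c prod_encode_inverse fst_conv snd_conv unfolding r by auto
    ultimately show thesis using that by blast
  qed
  then show "c \<in> codes"
  proof cases
    case 1
    then show ?thesis by (intro image_eqI[of _ _ "Atom p"]) (auto simp: c L_dyn_def)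
  next
    case 2
    then show ?thesis by (intro image_eqI[of _ _ "Dec x"]) (auto simp: c L_dyn_def)
  next
    case 3
    then consider "c = code Atm Val (Neg \<phi>)" | "c = code Atm Val (BoxI \<phi>)" | "c = code Atm Val (BoxF \<phi>)"
      unfolding c by auto
    then show ?thesis using 3(2) by cases (rule image_eqI, assumption, simp add: L_dyn_def)+
  next
    case 4
    then consider "c = code Atm Val (Conj \<phi> \<psi>)" | "c = code Atm Val (Dyn \<phi> \<psi>)"
      unfolding c r by auto
    then show ?thesis using 4(2,3) by cases (rule image_eqI, assumption, simp add: L_dyn_def)+
  qed
qed

lemma pr_codes: "rc n f \<Longrightarrow> pr n (\<lambda>xs. f xs \<in> codes)"
proof (rule pr_course_of_values[where G = code_step, OF codes_eq code_step_cong])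
  \<comment> \<open>Only the image of the enumeration enters; it is an initial segment of
    \<open>nat\<close> or all of it, hence recursive.\<close>
  have "pr n (\<lambda>xs. f xs \<in> to_nat_on Atm ` Atm)" if "rc n f" for n f
  proof (cases "finite Atm")
    case True
    then have "to_nat_on Atm ` Atm = {..<card Atm}" using to_nat_on_finite by (auto simp: bij_betw_def)
    then show ?thesis using that by (auto intro: recursive_intros)
  next
    case False
    then show ?thesis using image_to_nat_on[OF cA] by (auto intro: recursive_intros)
  qed
  note Atm = this
  show "pr n (\<lambda>xs. code_step (f xs) (\<lambda>x. x \<in> set_decode (h xs)))" if "rc n f" "rc n h" for n f h
    unfolding code_step_def by (intro Atm recursive_intros that)
qed

section \<open>Truth tables over the updates of a finite model\<close>

text \<open>\<open>\<sigma>\<close> codes the rows and \<open>v\<close> the columns left after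
  earlier announcements. Members of a coded set are below its code, so all quantifiers are bounded.
  The update is found as the \<open>v' \<le> v\<close> that codes the surviving columns, since a
  subset never has a larger code.\<close>

definition truth_step :: "(nat \<Rightarrow> nat \<Rightarrow> nat \<Rightarrow> nat \<Rightarrow> bool) \<Rightarrow> nat \<Rightarrow> nat \<Rightarrow> nat \<Rightarrow> nat \<Rightarrow> nat \<Rightarrow> bool" where
  "truth_step P \<sigma> c v s f \<longleftrightarrow>
    fst (prod_decode c) = 0 \<and> snd (prod_decode c) \<in> set_decode s \<or>
    fst (prod_decode c) = 1 \<and> f div card Val ^ s mod card Val = snd (prod_decode c) \<or>
    fst (prod_decode c) = 2 \<and> \<not> P (snd (prod_decode c)) v s f \<or>
    fst (prod_decode c) = 3 \<and> P (fst (prod_decode (snd (prod_decode c)))) v s f \<and>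
      P (snd (prod_decode (snd (prod_decode c)))) v s f \<or>
    fst (prod_decode c) = 4 \<and> (\<forall>s'<\<sigma>. s' \<in> set_decode \<sigma> \<longrightarrow> P (snd (prod_decode c)) v s' f) \<or>
    fst (prod_decode c) = 5 \<and> (\<forall>f'<v. f' \<in> set_decode v \<longrightarrow> P (snd (prod_decode c)) v s f') \<or>
    fst (prod_decode c) = 6 \<and>
      ((\<forall>s'<\<sigma>. s' \<in> set_decode \<sigma> \<longrightarrow> P (fst (prod_decode (snd (prod_decode c)))) v s' f) \<longrightarrow>
       (\<exists>v'\<le>v. (\<forall>f'<v. f' \<in> set_decode v' \<longleftrightarrow> f' \<in> set_decode v \<and>
             (\<forall>s'<\<sigma>. s' \<in> set_decode \<sigma> \<longrightarrow> P (fst (prod_decode (snd (prod_decode c)))) v s' f')) \<and>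
          P (snd (prod_decode (snd (prod_decode c)))) v' s f))"

abbreviation "truth \<sigma> \<phi> v \<equiv> nholds Atm Val \<phi> (set_decode \<sigma>) (set_decode v)"

lemma all_set_decode: "(\<forall>x<a. x \<in> set_decode a \<longrightarrow> Q x) \<longleftrightarrow> (\<forall>x\<in>set_decode a. Q x)"
  using set_decode_less by blast

text \<open>The ranges given by \<open>u\<close> and \<open>\<sigma>\<close> are closed under moving
  to another row or column of the model and under updates, so correctness of \<open>P\<close> at
  smaller codes suffices.\<close>

lemma truth_step_correct:
  assumes \<phi>: "\<phi> \<in> L_dyn Atm Val"
    and P: "\<And>\<chi> v s f. \<chi> \<in> L_dyn Atm Val \<Longrightarrow> code Atm Val \<chi> < code Atm Val \<phi> \<Longrightarrow> v \<le> u \<Longrightarrow> s \<le> \<sigma> \<Longrightarrow> f \<le> u \<Longrightarrow>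
      P (code Atm Val \<chi>) v s f \<longleftrightarrow> truth \<sigma> \<chi> v s f"
    and le: "v \<le> u" "s \<le> \<sigma>" "f \<le> u"
  shows "truth_step P \<sigma> (code Atm Val \<phi>) v s f \<longleftrightarrow> truth \<sigma> \<phi> v s f"
proof -
  have in\<sigma>: "s' \<le> \<sigma>" if "s' \<in> set_decode \<sigma>" for s' using set_decode_less[OF that] by simp
  have inv: "f' \<le> u" if "f' \<in> set_decode v" for f' using set_decode_less[OF that] le by simp
  have less1: "c < prod_encode (t, c)" if "t > 0" for c t using add_le_prod_encode[of t c] that by simp
  have less2: "c < prod_encode (t, prod_encode (c, d))" "d < prod_encode (t, prod_encode (c, d))" if "t > 0" for c d t
    using add_le_prod_encode[of t "prod_encode (c, d)"] add_le_prod_encode[of c d] that by simp_all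
  show ?thesis
  proof (cases \<phi>)
    case (Atom p)
    then show ?thesis by (simp add: truth_step_def row_val_def)
  next
    case (Dec x)
    let ?d = "f div card Val ^ s mod card Val"
    have "x \<in> Val" using \<phi> Dec by (simp add: L_dyn_def)
    \<comment> \<open>On output indices \<open>to_nat_on\<close> and \<open>from_nat_into\<close>
      are mutually inverse, so comparing digits is comparing outputs.\<close>
    moreover have "?d \<in> to_nat_on Val ` Val" using fV Val by (simp add: to_nat_on_Val card_gt_0_iff)
    ultimately have "?d = to_nat_on Val x \<longleftrightarrow> from_nat_into Val ?d = x"
      using countable_finite[OF fV] by force
    then show ?thesis using Dec by (simp add: truth_step_def digit_val_def)
  next
    case (Neg \<chi>)
    then show ?thesis using P[of \<chi>] \<phi> le less1 by (simp add: truth_step_def L_dyn_def)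
  next
    case (Conj \<chi> \<psi>)
    then show ?thesis using P[of \<chi>] P[of \<psi>] \<phi> le less2 by (simp add: truth_step_def L_dyn_def)
  next
    case (BoxI \<chi>)
    then have "P (code Atm Val \<chi>) v s' f \<longleftrightarrow> truth \<sigma> \<chi> v s' f" if "s' \<in> set_decode \<sigma>" for s'
      using P[of \<chi>] \<phi> le less1 in\<sigma>[OF that] by (simp add: L_dyn_def)
    then show ?thesis using BoxI by (simp add: truth_step_def all_set_decode)
  next
    case (BoxF \<chi>)
    then have "P (code Atm Val \<chi>) v s f' \<longleftrightarrow> truth \<sigma> \<chi> v s f'" if "f' \<in> set_decode v" for f'
      using P[of \<chi>] \<phi> le less1 inv[OF that] by (simp add: L_dyn_def)
    then show ?thesis using BoxF by (simp add: truth_step_def all_set_decode)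
  next
    case (Dyn \<chi> \<psi>)
    let ?A = "\<lambda>f'. \<forall>s'\<in>set_decode \<sigma>. truth \<sigma> \<chi> v s' f'"
    let ?D = "{f'\<in>set_decode v. ?A f'}"
    have \<chi>: "(\<forall>s'\<in>set_decode \<sigma>. P (code Atm Val \<chi>) v s' f') \<longleftrightarrow> ?A f'" if "f' \<le> u" for f'
      using Dyn P[of \<chi>] \<phi> le less2 in\<sigma> that by (simp add: L_dyn_def)
    have \<psi>: "P (code Atm Val \<psi>) v' s f \<longleftrightarrow> truth \<sigma> \<psi> v' s f" if "v' \<le> v" for v'
      using Dyn P[of \<psi>] \<phi> le less2 that by (simp add: L_dyn_def)
    \<comment> \<open>As \<open>v' \<le> v\<close>, members of either set are below
      \<open>v\<close>, so the test on \<open>f' < v\<close> settles equality of the sets.\<close>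
    have dec: "(\<forall>f'<v. f' \<in> set_decode v' \<longleftrightarrow> f' \<in> set_decode v \<and> (\<forall>s'\<in>set_decode \<sigma>. P (code Atm Val \<chi>) v s' f'))
        \<longleftrightarrow> set_decode v' = ?D" if "v' \<le> v" for v'
    proof -
      have "f' < v" if "f' \<in> set_decode v' \<or> f' \<in> set_decode v" for f'
        using that set_decode_less[of f'] \<open>v' \<le> v\<close> by fastforce
      moreover have "(\<forall>s'\<in>set_decode \<sigma>. P (code Atm Val \<chi>) v s' f') \<longleftrightarrow> ?A f'" if "f' < v" for f'
        using \<chi>[of f'] that le by simp
      ultimately show ?thesis by blast
    qed
    have D: "set_decode (set_encode ?D) = ?D" by simp
    then have "set_encode ?D \<le> v" by (intro subset_decode_imp_le) auto
    then have "(\<exists>v'\<le>v. set_decode v' = ?D \<and> truth \<sigma> \<psi> v' s f) \<longleftrightarrow>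
        nholds Atm Val \<psi> (set_decode \<sigma>) ?D s f"
      by (intro iffI; (elim exE conjE)?; (intro exI[of _ "set_encode ?D"])?; simp only: D simp_thms)
    moreover have "(\<exists>v'\<le>v. (\<forall>f'<v. f' \<in> set_decode v' \<longleftrightarrow> f' \<in> set_decode v \<and>
          (\<forall>s'\<in>set_decode \<sigma>. P (code Atm Val \<chi>) v s' f')) \<and> P (code Atm Val \<psi>) v' s f) \<longleftrightarrow>
        (\<exists>v'\<le>v. set_decode v' = ?D \<and> truth \<sigma> \<psi> v' s f)"
      by (intro ex_cong1 conj_cong refl; (rule dec \<psi>; assumption))
    ultimately show ?thesis using Dyn \<chi>[OF le(3)] by (simp add: truth_step_def all_set_decode)
  qed
qed

definition cell :: "nat \<Rightarrow> nat \<Rightarrow> nat \<Rightarrow> nat \<Rightarrow> nat \<Rightarrow> bool" where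
  "cell h c v s f \<longleftrightarrow> prod_encode (c, prod_encode (v, prod_encode (s, f))) \<in> set_decode h"

text \<open>Correctness is expressed locally, cell by cell, which needs only bounded quantifiers
  although truth is defined by recursion on formulas.\<close>

definition truth_table :: "nat \<Rightarrow> nat \<Rightarrow> nat \<Rightarrow> nat \<Rightarrow> bool" where
  "truth_table h n \<sigma> u \<longleftrightarrow> (\<forall>c\<le>n. c \<in> codes \<longrightarrow>
     (\<forall>v\<le>u. \<forall>s\<le>\<sigma>. \<forall>f\<le>u. cell h c v s f \<longleftrightarrow> truth_step (cell h) \<sigma> c v s f))"

lemma truth_table_exists: "\<exists>h. truth_table h n \<sigma> u"
proof -
  define H where "H = {prod_encode (c, prod_encode (v, prod_encode (s, f))) |c v s f.
    c \<le> n \<and> v \<le> u \<and> s \<le> \<sigma> \<and> f \<le> u \<and> (\<exists>\<phi>\<in>L_dyn Atm Val. c = code Atm Val \<phi> \<and> truth \<sigma> \<phi> v s f)}"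
  have "H \<subseteq> (\<lambda>(c, v, s, f). prod_encode (c, prod_encode (v, prod_encode (s, f)))) `
      ({..n} \<times> {..u} \<times> {..\<sigma>} \<times> {..u})" unfolding H_def by force
  then have "finite H" by (rule finite_subset) simp
  then have "cell (set_encode H) c v s f \<longleftrightarrow> prod_encode (c, prod_encode (v, prod_encode (s, f))) \<in> H" for c v s f
    by (simp add: cell_def)
  then have cell: "cell (set_encode H) (code Atm Val \<phi>) v s f \<longleftrightarrow> truth \<sigma> \<phi> v s f"
    if "\<phi> \<in> L_dyn Atm Val" "code Atm Val \<phi> \<le> n" "v \<le> u" "s \<le> \<sigma>" "f \<le> u" for \<phi> v s f
    using that inj_on_code[OF cA countable_finite[OF fV]] unfolding H_def inj_on_def by auto
  have "truth_step (cell (set_encode H)) \<sigma> (code Atm Val \<phi>) v s f \<longleftrightarrow> truth \<sigma> \<phi> v s f"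
    if "\<phi> \<in> L_dyn Atm Val" "code Atm Val \<phi> \<le> n" "v \<le> u" "s \<le> \<sigma>" "f \<le> u" for \<phi> v s f
    by (rule truth_step_correct) (use cell that in auto)
  with cell have "truth_table (set_encode H) n \<sigma> u" unfolding truth_table_def by auto
  then show ?thesis ..
qed

text \<open>Induction on codes: within the table, \<open>truth_step\<close> refers only to cells
  with smaller codes.\<close>

lemma truth_table_correct:
  assumes "truth_table h n \<sigma> u"
  shows "\<phi> \<in> L_dyn Atm Val \<Longrightarrow> code Atm Val \<phi> \<le> n \<Longrightarrow> v \<le> u \<Longrightarrow> s \<le> \<sigma> \<Longrightarrow> f \<le> u \<Longrightarrow>
    cell h (code Atm Val \<phi>) v s f \<longleftrightarrow> truth \<sigma> \<phi> v s f"
proof (induction "code Atm Val \<phi>" arbitrary: \<phi> v s f rule: less_induct)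
  case less
  have "truth_step (cell h) \<sigma> (code Atm Val \<phi>) v s f \<longleftrightarrow> truth \<sigma> \<phi> v s f"
    by (rule truth_step_correct) (use less in auto)
  then show ?case using assms less.prems unfolding truth_table_def by blast
qed

lemma rc_truth_table: "rc 3 (\<lambda>xs. LEAST h. truth_table h (hd xs) (hd (tl xs)) (hd (tl (tl xs))))"
proof (rule rc_Least)
  show "pr (Suc 3) (\<lambda>zs. truth_table (hd zs) (hd (tl zs)) (hd (tl (tl zs))) (hd (tl (tl (tl zs)))))"
    unfolding truth_table_def truth_step_def cell_def
    by (intro pr_codes recursive_intros) simp_all
qed (rule truth_table_exists)

section \<open>Assembling the decision procedure\<close>

lemma decidable: "pr 1 (\<lambda>xs. hd xs \<in> code Atm Val ` {\<phi> \<in> L_dyn Atm Val. satisfiable Atm Val \<phi>})"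
proof -
  \<comment> \<open>Finiteness of \<open>Atm\<close> and the two cardinalities are fixed data of the
    procedure, so \<open>M\<close> is recursive in the code.\<close>
  define M where "M n = (if finite Atm then card Atm else 2 * Suc n + card Val)" for n
  define H where "H n \<sigma> u = (LEAST h. truth_table h n \<sigma> u)" for n \<sigma> u
  have rc_M: "rc n f \<Longrightarrow> rc n (\<lambda>xs. M (f xs))" for n f
    unfolding M_def by (cases "finite Atm") (auto intro!: recursive_intros)
  have rc_H: "rc n f \<Longrightarrow> rc n g \<Longrightarrow> rc n h \<Longrightarrow> rc n (\<lambda>xs. H (f xs) (g xs) (h xs))" for n f g h
    unfolding H_def by (rule rc_subst3[OF rc_truth_table])
  have H: "truth_table (H n \<sigma> u) n \<sigma> u" for n \<sigma> u
    unfolding H_def using truth_table_exists by (rule LeastI_ex)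
  have "x \<in> code Atm Val ` {\<phi> \<in> L_dyn Atm Val. satisfiable Atm Val \<phi>} \<longleftrightarrow> x \<in> codes \<and>
    (\<exists>\<sigma><2 ^ 2 ^ M x. \<exists>u<2 ^ (card Val ^ 2 ^ M x * 2 ^ Suc x). \<exists>s<\<sigma>. \<exists>f<u.
       s \<in> set_decode \<sigma> \<and> f \<in> set_decode u \<and> cell (H x \<sigma> u) x u s f)" for x
  proof (cases "x \<in> codes")
    case True
    then obtain \<phi> where \<phi>: "\<phi> \<in> L_dyn Atm Val" "x = code Atm Val \<phi>" by blast
    have "x \<in> code Atm Val ` {\<phi> \<in> L_dyn Atm Val. satisfiable Atm Val \<phi>} \<longleftrightarrow> satisfiable Atm Val \<phi>"
      using \<phi> inj_on_code[OF cA countable_finite[OF fV]] unfolding inj_on_def by auto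
    also have "\<dots> \<longleftrightarrow> (\<exists>\<sigma><2 ^ 2 ^ M x. \<exists>u<2 ^ (card Val ^ 2 ^ M x * 2 ^ Suc x).
        \<exists>s\<in>set_decode \<sigma>. \<exists>f\<in>set_decode u. truth \<sigma> \<phi> u s f)"
      unfolding \<phi>(2) by (rule satisfiable_iff_bounded[OF cA fV Val \<phi>(1) M_def])
    also have "\<dots> \<longleftrightarrow> (\<exists>\<sigma><2 ^ 2 ^ M x. \<exists>u<2 ^ (card Val ^ 2 ^ M x * 2 ^ Suc x).
        \<exists>s<\<sigma>. \<exists>f<u. s \<in> set_decode \<sigma> \<and> f \<in> set_decode u \<and> cell (H x \<sigma> u) x u s f)"
    proof -
      have "(\<exists>s\<in>set_decode \<sigma>. \<exists>f\<in>set_decode u. truth \<sigma> \<phi> u s f) \<longleftrightarrow>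
          (\<exists>s<\<sigma>. \<exists>f<u. s \<in> set_decode \<sigma> \<and> f \<in> set_decode u \<and> cell (H x \<sigma> u) x u s f)" for \<sigma> u
      proof -
        have "cell (H x \<sigma> u) x u s f \<longleftrightarrow> truth \<sigma> \<phi> u s f" if "s < \<sigma>" "f < u" for s f
          unfolding \<phi>(2) using truth_table_correct[OF H \<phi>(1)] that by simp
        then show ?thesis using set_decode_less by blast
      qed
      then show ?thesis by simp
    qed
    finally show ?thesis using True by simp
  qed auto
  moreover have "pr 1 (\<lambda>xs. hd xs \<in> codes \<and>
    (\<exists>\<sigma><2 ^ 2 ^ M (hd xs). \<exists>u<2 ^ (card Val ^ 2 ^ M (hd xs) * 2 ^ Suc (hd xs)). \<exists>s<\<sigma>. \<exists>f<u.
       s \<in> set_decode \<sigma> \<and> f \<in> set_decode u \<and> cell (H (hd xs) \<sigma> u) (hd xs) u s f))"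
    unfolding cell_def by (intro pr_codes rc_M rc_H recursive_intros) simp_all
  ultimately show ?thesis by simp
qed

end

theorem theorem10:
  fixes Atm :: "'a set" and Val :: "'v set"
  assumes "countable Atm" and "finite Val"
  shows "decidable_set (code Atm Val ` {\<phi> \<in> L_dyn Atm Val. satisfiable Atm Val \<phi>})"
proof -
  let ?A = "code Atm Val ` {\<phi> \<in> L_dyn Atm Val. satisfiable Atm Val \<phi>}"
  have "pr 1 (\<lambda>xs. hd xs \<in> ?A)"
  \<comment> \<open>If \<open>Val\<close> is empty, a model with a row has no classifier, so nothing
    is satisfiable and the set of codes is empty.\<close>
  proof (cases "Val = {}")
    case True
    then have "\<not> satisfiable Atm Val \<phi>" for \<phi>
      unfolding satisfiable_def MCM_def by fastforce
    then show ?thesis by (simp add: pr_const)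
  next
    case False
    then interpret decision Atm Val by unfold_locales (use assms in auto)
    show ?thesis by (rule decidable)
  qed
  then obtain d where "recursive 1 d" "\<And>xs. length xs = 1 \<Longrightarrow> d xs = (if hd xs \<in> ?A then 1 else 0)"
    unfolding pr_def rc_def by auto
  then show ?thesis unfolding decidable_set_def by (intro exI[of _ d]) simp
qed

end
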